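(* Let $m\in\mathbb{N}$, $p\in(1,\infty)$, let $E\subset\mathbb{R}$ be a closed set with $\#E\ge m+1$, and let $f:E\to\mathbb{R}$ be a function with $\mathcal{L}_{m,p}(f:E)<\infty$. Let $\{P_x:x\in E\}$ be the Whitney $(m-1)$-field $\mathbf{P}^{(m,E)}[f]$ associated with $f$. Let $k\in\mathbb{N}$, $\varepsilon>0$, and let $X=\{x_1,\dots,x_k\}\subset E$, $x_1<\dots<x_k$, be a sequence of points in $E$. Then there exist a positive integer $\ell\ge m$, a finite strictly increasing sequence $V=\{v_1,\dots,v_\ell\}$ of points in $E$, and a mapping $H:X\to2^V$ such that: (1) For every $x\in X$ the set $H(x)$ consists of $m$ consecutive points of the sequence $V$; thus $H(x)=\{v_{j_1(x)},\dots,v_{j_2(x)}\}$ where $1\le j_1(x)\le j_2(x)=j_1(x)+m-1\le\ell$; (2) $x\in H(x)$ for each $x\in X$; in particular $X\subset V$. Furthermore, given $i\in\{1,\dots,k-1\}$, let $x_i=v_{\varkappa_i}$ and $x_{i+1}=v_{\varkappa_{i+1}}$; then $0<\varkappa_{i+1}-\varkappa_i\le2m$; (3) If $x',x''\in X$, $x'<x''$, then $\min H(x')\le\min H(x'')$ and $\max H(x')\le\max H(x'')$; (4) For every $x',x''\in X$ such that $H(x')\ne H(x'')$, $$\operatorname{diam}H(x')+\operatorname{diam}H(x'')\le2(m+1)\,|x'-x''|;$$ (5) For every $x,y\in X$ and every $i$, $0\le i\le m-1$, $\ |P_x^{(i)}(y)-L_{H(x)}^{(i)}[f](y)|<\vare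psilon$.
   Context: Notation. For a finite set $S\subset\mathbb{R}$ with $\#S=k+1$, $L_S[f]$ is the Lagrange polynomial of degree at most $k$ interpolating $f$ on $S$, and $\Delta^kf[S]$ is the coefficient of $x^k$ in $L_S[f]$; superscripts $(i)$ denote $i$-th derivatives. $2^V$ is the family of subsets of $V$. $\mathcal{L}_{m,p}(f:E)$ is the supremum of $\bigl(\sum_{i=0}^{n-m}(x_{i+m}-x_i)|\Delta^mf[x_i,\dots,x_{i+m}]|^p\bigr)^{1/p}$ over all finite strictly increasing sequences $\{x_0,\dots,x_n\}\subset E$ with $n\ge m$. The notation $S\to z$ means $\operatorname{diam}(S\cup\{z\})\to0$. The sets $S_x$ and points $s_x$. To each nonempty finite set $A\subset E$, $A\neq E$, containing at most one limit point of $E$, assign a point $a_E(A)\in E$: if $A$ contains no limit point of $E$, then $a_E(A)$ is a point of $E\setminus A$ nearest to $A$ (one fixed choice for each $A$); if $A$ contains a (unique) limit point $a$ of $E$, then $a_E(A)=a$. For $x\in E$ put $y_0(x)=x$, $Y_0(x)=\{x\}$. Inductively, given $Y_j(x)=\{y_0(x),\dots,y_j(x)\}$: if $j=m-1$ or $y_j(x)$ is a limit point of $E$, stop and put $n(x)=j$; otherwise put $y_{j+1}(x)=a_E(Y_j(x))$ and $Y_{j+1}(x)=Y_j(x)\cup\{y_{j+1}(x)\}$. Set $S_x=Y_{n(x)}(x)$ and $s_x=y_{n(x)}(x)$. Then $\#S_x\le m$, and $s_x$ is a limit point of $E$ if $\#S_x<m$. The field $\mathbf{P}^{(m,E)}[f]=\{P_x:x\in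 E\}$ consists of polynomials $P_x$ of degree at most $m-1$ defined as follows. If $\#S_x=m$, then $P_x=L_{S_x}[f]$. If $\#S_x<m$, then the limits $f_i(s_x)=\lim_{S\to s_x,\ S\subset E,\ \#S=m}L^{(i)}_S[f](s_x)$, $0\le i\le m-1$, exist (a consequence of $\mathcal{L}_{m,p}(f:E)<\infty$), and $P_x$ is the unique (Hermite) polynomial of degree at most $m-1$ with $P_x(y)=f(y)$ for every $y\in S_x$ and $P_x^{(i)}(s_x)=f_i(s_x)$ for every $1\le i\le m-\#S_x$. *)

theory Defs
  imports "HOL-Analysis.Analysis" "HOL-Computational_Algebra.Polynomial"
begin

text \<open>
  A function on a subset \<open>E\<close> of the real line is a total function of type \<open>real \<Rightarrow> real\<close>
  of which only the values on \<open>E\<close> are used.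
\<close>

definition lagrange_poly :: "real set \<Rightarrow> (real \<Rightarrow> real) \<Rightarrow> real poly" where
  "lagrange_poly S f = (THE q. degree q \<le> card S - 1 \<and> (\<forall>x\<in>S. poly q x = f x))"

lemma ex1_lagrange_poly:
  fixes S :: "real set" and f :: "real \<Rightarrow> real"
  assumes fin: "finite S" and ne: "S \<noteq> {}"
  shows "\<exists>!q. degree q \<le> card S - 1 \<and> (\<forall>x\<in>S. poly q x = f x)"
proof (rule ex_ex1I)
  define w where "w x = (\<Prod>y\<in>S - {x}. [:- y, 1:])" for x
  define q where "q = (\<Sum>x\<in>S. smult (f x / poly (w x) x) (w x))"
  have deg: "degree (w x) \<le> card S - 1" if "x \<in> S" for x
    using degree_prod_sum_le[of "S - {x}" "\<lambda>y. [:- y, 1:]"] that fin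
    by (simp add: w_def o_def)
  have nz: "poly (w x) x \<noteq> 0" for x
    using fin by (simp add: w_def poly_prod)
  have z: "poly (w x) y = 0" if "y \<in> S" "y \<noteq> x" for x y
    using fin that by (auto simp: w_def poly_prod)
  have "degree q \<le> card S - 1"
    unfolding q_def using deg
    by (intro degree_sum_le fin) (auto intro: order.trans[OF degree_smult_le])
  moreover have "poly q y = f y" if "y \<in> S" for y
  proof -
    have "poly q y = (\<Sum>x\<in>S. if x = y then f y else 0)"
      unfolding q_def poly_sum using that nz z by (intro sum.cong) auto
    then show ?thesis using that fin by simp
  qed
  ultimately show "\<exists>q. degree q \<le> card S - 1 \<and> (\<forall>x\<in>S. poly q x = f x)" by blast
next
  fix q r :: "real poly"
  assume q: "degree q \<le> card S - 1 \<and> (\<forall>x\<in>S. poly q x = f x)"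
    and r: "degree r \<le> card S - 1 \<and> (\<forall>x\<in>S. poly r x = f x)"
  show "q = r"
  proof (rule ccontr)
    assume "q \<noteq> r"
    then have nz: "q - r \<noteq> 0" by simp
    have "card S \<le> card {x. poly (q - r) x = 0}"
      using q r by (intro card_mono poly_roots_finite nz) auto
    also have "\<dots> \<le> degree (q - r)" by (rule card_poly_roots_bound[OF nz])
    also have "\<dots> \<le> card S - 1" using q r by (intro degree_diff_le) auto
    finally have "card S \<le> card S - 1" .
    moreover have "0 < card S" using fin ne by (simp add: card_gt_0_iff)
    ultimately show False by linarith
  qed
qed

text \<open>The divided difference over \<open>k + 1\<close> points.\<close>

definition divided_diff :: "nat \<Rightarrow> (real \<Rightarrow> real) \<Rightarrow> real set \<Rightarrow> real" where
  "divided_diff k f S = coeff (lagrange_poly S f) k"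

definition variational_norm :: "nat \<Rightarrow> real \<Rightarrow> (real \<Rightarrow> real) \<Rightarrow> real set \<Rightarrow> ennreal" where
  "variational_norm m p f E =
    (SUP (n, x) \<in> {(n, x :: nat \<Rightarrow> real). m \<le> n \<and> strict_mono_on {0..n} x \<and> x ` {0..n} \<subseteq> E}.
       ennreal ((\<Sum>i = 0..n - m. (x (i + m) - x i) *
                   \<bar>divided_diff m f (x ` {i..i + m})\<bar> powr p) powr (1 / p)))"

text \<open>
  \<open>is_choice_fun E a\<close> says that \<open>a\<close> is an admissible map $A \mapsto a_E(A)$; its values outside
  the stated domain are irrelevant.
\<close>

definition is_choice_fun :: "real set \<Rightarrow> (real set \<Rightarrow> real) \<Rightarrow> bool" where
  "is_choice_fun E a \<longleftrightarrow>
    (\<forall>A. finite A \<and> A \<noteq> {} \<and> A \<subseteq> E \<and> A \<noteq> E \<longrightarrow>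
       ((\<forall>z\<in>A. \<not> z islimpt E) \<longrightarrow>
          a A \<in> E - A \<and> (\<forall>y\<in>E - A. infdist (a A) A \<le> infdist y A)) \<and>
       (\<forall>z. {u\<in>A. u islimpt E} = {z} \<longrightarrow> a A = z))"

text \<open>
  The sequence \<open>y_pt a x 0, y_pt a x 1, \<dots>\<close> is not cut off at the stopping index; only
  the terms up to \<open>stop_index\<close> are used.
\<close>

function y_pt :: "(real set \<Rightarrow> real) \<Rightarrow> real \<Rightarrow> nat \<Rightarrow> real" where
  "y_pt a x 0 = x"
| "y_pt a x (Suc j) = a (y_pt a x ` {0..j})"
  by pat_completeness auto
termination by (relation "Wellfounded.measure (\<lambda>(a, x, j). j)") auto

definition stop_index :: "nat \<Rightarrow> real set \<Rightarrow> (real set \<Rightarrow> real) \<Rightarrow> real \<Rightarrow> nat" where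
  "stop_index m E a x = (LEAST j. j = m - 1 \<or> y_pt a x j islimpt E)"

definition S_set :: "nat \<Rightarrow> real set \<Rightarrow> (real set \<Rightarrow> real) \<Rightarrow> real \<Rightarrow> real set" where
  "S_set m E a x = y_pt a x ` {0..stop_index m E a x}"

definition s_pt :: "nat \<Rightarrow> real set \<Rightarrow> (real set \<Rightarrow> real) \<Rightarrow> real \<Rightarrow> real" where
  "s_pt m E a x = y_pt a x (stop_index m E a x)"

text \<open>
  The filter of \<open>m\<close>-point subsets \<open>S\<close> of \<open>E\<close> with \<open>S \<rightarrow> z\<close>, i.e. with the diameter of
  \<open>insert z S\<close> tending to \<open>0\<close>.
\<close>

definition sets_to :: "nat \<Rightarrow> real set \<Rightarrow> real \<Rightarrow> real set filter" where
  "sets_to m E z =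
     inf (filtercomap (\<lambda>S. diameter (insert z S)) (nhds 0))
         (principal {S. finite S \<and> S \<subseteq> E \<and> card S = m})"

definition limit_deriv :: "nat \<Rightarrow> real set \<Rightarrow> (real \<Rightarrow> real) \<Rightarrow> nat \<Rightarrow> real \<Rightarrow> real" where
  "limit_deriv m E f i z =
     Lim (sets_to m E z) (\<lambda>S. poly ((pderiv ^^ i) (lagrange_poly S f)) z)"

definition whitney_field ::
    "nat \<Rightarrow> real set \<Rightarrow> (real set \<Rightarrow> real) \<Rightarrow> (real \<Rightarrow> real) \<Rightarrow> real \<Rightarrow> real poly" where
  "whitney_field m E a f x =
     (if card (S_set m E a x) = m then lagrange_poly (S_set m E a x) f
      else (THE q. degree q \<le> m - 1 \<and>
              (\<forall>y\<in>S_set m E a x. poly q y = f y) \<and>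
              (\<forall>i\<in>{1..m - card (S_set m E a x)}.
                 poly ((pderiv ^^ i) q) (s_pt m E a x) = limit_deriv m E f i (s_pt m E a x))))"

end

theory Submission
  imports Defs
begin

text \<open>
  Exchanging one node \<open>a\<close> of an interpolation set for a node \<open>b\<close> changes the Lagrange polynomial by
  $(a - b)\,\Delta^m f[U] \prod_{u \in U \setminus \{a, b\}} (t - u)$, where \<open>U\<close> has \<open>m + 1\<close> points, and
  finiteness of the norm gives $|\Delta^m f[U]|\,\mathrm{diam}\,U \le C\,(\mathrm{diam}\,U)^{1 - 1/p}$.
  Hence the Lagrange polynomials of sets shrinking to a limit point have converging derivatives there.
  A set $H(x)$ is obtained from $S_x$ by adding $m - \# S_x$ points of \<open>E\<close> very close to $s_x$, all on one
  side of $s_x$ that depends only on the point $s_x$. Passing from $H(x)$ to an \<open>m\<close>-point set near $s_x$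
  keeps $m - \# S_x + 1$ nodes near $s_x$, so the derivatives at $s_x$ up to order $m - \# S_x$ change
  little; the Hermite basis for the data of $P_x$ turns this into (5). The ordering and
  diameter estimates for $H$ are inherited from those for $S_x$: if $S_x \ne S_y$, no step in the
  construction of $S_x$ jumps further than $|x - y|$.
\<close>

section \<open>Node polynomials, Lagrange and Hermite interpolation\<close>

text \<open>Several points \<open>x\<close> may stop at the same limit point with sets
  \<open>S x\<close> of different size, and points added for one \<open>x\<close> must not break up
  \<open>H x'\<close> for another. So one increasing sequence of distances, all below
  \<open>\<delta>\<close>, is fixed at each limit point, and every \<open>x\<close> takes an initial
  segment of it. Distinct points of the union of the \<open>S x\<close> are at least
  \<open>2 * \<delta>\<close> apart, so points added at different limit points do not mix. The sets
  \<open>H x\<close> become runs of consecutive points of \<open>V\<close>, although not of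
  \<open>E\<close>. The same \<open>\<delta>\<close> must make the errors in (5) small before the
  added points are known. Hence the approximation results hold for all small
  \<open>\<delta>\<close>, uniformly in the added points, and finitely many of them can be
  combined.\<close>

lemma
  fixes S :: "real set" and f :: "real \<Rightarrow> real"
  assumes "finite S" "S \<noteq> {}"
  shows degree_lagrange_poly: "degree (lagrange_poly S f) \<le> card S - 1"
    and poly_lagrange_poly: "z \<in> S \<Longrightarrow> poly (lagrange_poly S f) z = f z"
  using theI'[OF ex1_lagrange_poly[OF assms, of f]] unfolding lagrange_poly_def by auto

lemma poly_eq_0_of_roots:
  fixes q :: "real poly"
  assumes "finite S" "S \<noteq> {}" "degree q \<le> card S - 1" "\<And>z. z \<in> S \<Longrightarrow> poly q z = 0"
  shows "q = 0"
  using ex1_lagrange_poly[OF assms(1,2), of "\<lambda>_. 0"] assms(3,4) by (metis degree_0 le0 poly_0)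

definition node_poly :: "real set \<Rightarrow> real poly" where
  "node_poly S = (\<Prod>u\<in>S. [:- u, 1:])"

lemma node_poly_insert:
  "finite S \<Longrightarrow> u \<notin> S \<Longrightarrow> node_poly (insert u S) = [:- u, 1:] * node_poly S"
  by (simp add: node_poly_def)

lemma poly_node_poly_eq_0: "finite S \<Longrightarrow> z \<in> S \<Longrightarrow> poly (node_poly S) z = 0"
  by (auto simp: node_poly_def poly_prod)

lemma degree_coeff_node_poly:
  assumes "finite S"
  shows "degree (node_poly S) = card S \<and> coeff (node_poly S) (card S) = 1"
  using assms
proof (induction S rule: finite_induct)
  case empty
  then show ?case by (simp add: node_poly_def)
next
  case (insert u S)
  then have nz: "node_poly S \<noteq> 0" by auto
  have deg: "degree (node_poly (insert u S)) = card (insert u S)"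
    using insert nz by (simp add: node_poly_insert degree_mult_eq del: mult_pCons_left)
  have "lead_coeff (node_poly (insert u S)) = 1"
    unfolding node_poly_insert[OF insert.hyps] lead_coeff_mult using insert by simp
  then show ?case using deg by simp
qed

text \<open>Newton's formula. Subtracting the monic node polynomial times the top coefficient
  removes the term of degree \<open>card A\<close>; what remains has degree below
  \<open>card A\<close> and vanishes on \<open>A\<close>.\<close>

lemma lagrange_poly_insert:
  assumes "finite A" "A \<noteq> {}" "b \<notin> A"
  shows "lagrange_poly (insert b A) f - lagrange_poly A f =
    smult (divided_diff (card A) f (insert b A)) (node_poly A)"
proof -
  define c where "c = divided_diff (card A) f (insert b A)"
  define q where "q = lagrange_poly (insert b A) f - lagrange_poly A f - smult c (node_poly A)"
  have cA: "card A > 0" using assms by (simp add: card_gt_0_iff)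
  have d1: "degree (lagrange_poly (insert b A) f) \<le> card A"
    using degree_lagrange_poly[of "insert b A" f] assms by simp
  have d2: "degree (lagrange_poly A f) < card A"
    using degree_lagrange_poly[of A f] assms cA by linarith
  have nd: "degree (node_poly A) = card A" "coeff (node_poly A) (card A) = 1"
    using degree_coeff_node_poly[of A] assms by auto
  have "degree q \<le> card A"
    unfolding q_def using d1 d2 nd by (intro degree_diff_le) auto
  moreover have "coeff q (card A) = 0"
    using d2 nd by (simp add: q_def c_def divided_diff_def coeff_eq_0)
  ultimately have "degree q \<le> card A - 1"
    using cA by (intro degree_le allI impI)
      (metis Suc_pred' coeff_eq_0 le_eq_less_or_eq less_eq_Suc_le order_le_less_trans)
  moreover have "poly q z = 0" if "z \<in> A" for z
    using that assms by (simp add: q_def poly_lagrange_poly poly_node_poly_eq_0)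
  ultimately have "q = 0" using poly_eq_0_of_roots assms by blast
  then show ?thesis by (simp add: q_def c_def)
qed

text \<open>Two Newton steps end at the same set \<open>insert a (insert b J)\<close> and so share
  one divided difference; their node polynomials differ in one linear factor.\<close>

lemma lagrange_poly_exchange:
  assumes "finite J" "a \<notin> J" "b \<notin> J" "a \<noteq> b"
  shows "lagrange_poly (insert a J) f - lagrange_poly (insert b J) f =
    smult (divided_diff (card J + 1) f (insert a (insert b J)) * (a - b)) (node_poly J)"
proof -
  have 1: "lagrange_poly (insert b (insert a J)) f - lagrange_poly (insert a J) f =
      smult (divided_diff (card J + 1) f (insert b (insert a J))) (node_poly (insert a J))"
    using lagrange_poly_insert[of "insert a J" b f] assms by simp
  have 2: "lagrange_poly (insert a (insert b J)) f - lagrange_poly (insert b J) f =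
      smult (divided_diff (card J + 1) f (insert a (insert b J))) (node_poly (insert b J))"
    using lagrange_poly_insert[of "insert b J" a f] assms by simp
  have 3: "node_poly (insert b J) - node_poly (insert a J) = smult (a - b) (node_poly J)"
    using assms by (simp add: node_poly_insert algebra_simps flip: smult_diff_left)
  have "lagrange_poly (insert a J) f - lagrange_poly (insert b J) f =
    smult (divided_diff (card J + 1) f (insert a (insert b J)))
      (node_poly (insert b J) - node_poly (insert a J))"
    using 1 2 by (simp add: insert_commute[of b a] smult_diff_right)
  then show ?thesis by (simp add: 3)
qed

section \<open>Higher derivatives of node polynomials\<close>

lemma higher_pderiv_const: "(pderiv ^^ Suc i) [:c :: real:] = 0"
  by (simp add: funpow_Suc_right pderiv_pCons del: funpow.simps)

text \<open>Leibniz rule with one linear factor. At \<open>i = 0\<close> the truncated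
  \<open>i - 1\<close> does no harm, since its coefficient is \<open>0\<close>.\<close>

lemma higher_pderiv_linear_mult:
  fixes q :: "real poly"
  shows "(pderiv ^^ i) ([:- u, 1:] * q) =
    [:- u, 1:] * (pderiv ^^ i) q + smult (real i) ((pderiv ^^ (i - 1)) q)"
proof (induction i)
  case 0
  then show ?case by simp
next
  case (Suc i)
  have p: "pderiv [:- u, 1:] = 1" by (simp add: pderiv_pCons)
  have s: "smult (real i) (pderiv ((pderiv ^^ (i - 1)) q)) = smult (real i) ((pderiv ^^ i) q)"
  proof (cases i)
    case (Suc l)
    then have "pderiv ((pderiv ^^ (i - 1)) q) = (pderiv ^^ i) q" by simp
    then show ?thesis by (rule arg_cong)
  qed simp
  have "(pderiv ^^ Suc i) ([:- u, 1:] * q) =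
    [:- u, 1:] * pderiv ((pderiv ^^ i) q) + (pderiv ^^ i) q + smult (real i) ((pderiv ^^ i) q)"
    by (simp add: Suc.IH pderiv_add pderiv_mult p pderiv_smult s del: mult_pCons_left One_nat_def)
  then show ?case by (simp add: smult_add_left del: mult_pCons_left)
qed

corollary poly_higher_pderiv_linear_mult:
  fixes q :: "real poly"
  shows "poly ((pderiv ^^ i) ([:- u, 1:] * q)) z =
    (z - u) * poly ((pderiv ^^ i) q) z + real i * poly ((pderiv ^^ (i - 1)) q) z"
  unfolding higher_pderiv_linear_mult by (simp add: algebra_simps)

lemma higher_pderiv_diff:
  fixes q r :: "real poly"
  shows "(pderiv ^^ i) (q - r) = (pderiv ^^ i) q - (pderiv ^^ i) r"
  by (induction i) (simp_all add: pderiv_diff)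

text \<open>Each differentiation removes one factor. With more than \<open>i\<close> nodes within
  \<open>\<delta>\<close> of \<open>z\<close>, every term of the \<open>i\<close>-th derivative
  keeps a factor of size at most \<open>\<delta>\<close>. The base \<open>R + i\<close> comes from
  the product rule: a further node contributes \<open>R\<close> through its own factor and
  \<open>i\<close> when that factor is differentiated.\<close>

lemma node_poly_deriv_bound:
  fixes R \<delta> z :: real
  assumes "finite J" "\<And>u. u \<in> J \<Longrightarrow> \<bar>z - u\<bar> \<le> R" "1 \<le> R" "0 < \<delta>" "\<delta> \<le> 1"
  shows "\<bar>poly ((pderiv ^^ i) (node_poly J)) z\<bar> \<le> (R + i) ^ card J"
    and "i < card {u\<in>J. \<bar>z - u\<bar> \<le> \<delta>} \<Longrightarrow>
      \<bar>poly ((pderiv ^^ i) (node_poly J)) z\<bar> \<le> \<delta> * (R + i) ^ card J"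
proof -
  \<comment> \<open>Both bounds are proved together for all \<open>i\<close>: the product rule
    involves \<open>i - 1\<close>, and a new node near \<open>z\<close> supplies
    \<open>\<delta>\<close> by itself, so that the first bound suffices for the rest.\<close>
  have "\<forall>i. \<bar>poly ((pderiv ^^ i) (node_poly J)) z\<bar> \<le> (R + real i) ^ card J \<and>
     (i < card {u\<in>J. \<bar>z - u\<bar> \<le> \<delta>} \<longrightarrow>
      \<bar>poly ((pderiv ^^ i) (node_poly J)) z\<bar> \<le> \<delta> * (R + real i) ^ card J)"
    using assms
  proof (induction J rule: finite_induct)
    case empty
    have "\<bar>poly ((pderiv ^^ i) (1 :: real poly)) z\<bar> \<le> 1" for i
      using higher_pderiv_const[of "i - 1" 1] by (cases i) (simp_all add: one_pCons)
    then show ?case by (simp add: node_poly_def)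
  next
    case (insert u J)
    define c where "c = card {u\<in>J. \<bar>z - u\<bar> \<le> \<delta>}"
    let ?d = "\<lambda>i. poly ((pderiv ^^ i) (node_poly J)) z"
    have IH: "\<bar>?d i\<bar> \<le> (R + real i) ^ card J"
      "i < c \<Longrightarrow> \<bar>?d i\<bar> \<le> \<delta> * (R + real i) ^ card J" for i
      using insert unfolding c_def by auto
    have mono: "real i * (R + real (i - 1)) ^ card J \<le> real i * (R + real i) ^ card J" for i
      using insert.prems by (intro mult_left_mono power_mono) auto
    have step: "\<bar>poly ((pderiv ^^ i) (node_poly (insert u J))) z\<bar> \<le>
        \<bar>z - u\<bar> * \<bar>?d i\<bar> + real i * \<bar>?d (i - 1)\<bar>" for i
      unfolding node_poly_insert[OF insert.hyps] poly_higher_pderiv_linear_mult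
      using abs_triangle_ineq[of "(z - u) * ?d i" "real i * ?d (i - 1)"] by (simp add: abs_mult)
    have zu: "\<bar>z - u\<bar> \<le> R" using insert.prems by auto
    have nn: "0 \<le> (R + real i) ^ card J" for i using insert.prems by simp
    have pw: "(R + real i) ^ card (insert u J) = R * (R + real i) ^ card J + real i * (R + real i) ^ card J" for i
      using insert.hyps by (simp add: algebra_simps)
    have A: "\<bar>poly ((pderiv ^^ i) (node_poly (insert u J))) z\<bar> \<le> (R + real i) ^ card (insert u J)" for i
    proof -
      have "\<bar>z - u\<bar> * \<bar>?d i\<bar> \<le> R * (R + real i) ^ card J"
        using zu IH(1) insert.prems by (intro mult_mono) auto
      moreover have "real i * \<bar>?d (i - 1)\<bar> \<le> real i * (R + real i) ^ card J"
        using mono[of i] mult_left_mono[OF IH(1)[of "i - 1"], of "real i"] by linarith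
      ultimately show ?thesis using step[of i] pw[of i] by linarith
    qed
    have B: "\<bar>poly ((pderiv ^^ i) (node_poly (insert u J))) z\<bar> \<le> \<delta> * (R + real i) ^ card (insert u J)"
      if i: "i < card {v\<in>insert u J. \<bar>z - v\<bar> \<le> \<delta>}" for i
    proof -
      have c1: "card {v\<in>insert u J. \<bar>z - v\<bar> \<le> \<delta>} = (if \<bar>z - u\<bar> \<le> \<delta> then Suc c else c)"
      proof -
        have "{v\<in>insert u J. \<bar>z - v\<bar> \<le> \<delta>} =
          (if \<bar>z - u\<bar> \<le> \<delta> then insert u {v\<in>J. \<bar>z - v\<bar> \<le> \<delta>} else {v\<in>J. \<bar>z - v\<bar> \<le> \<delta>})" by auto
        then show ?thesis using insert.hyps by (simp add: c_def)
      qed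
      have 2: "real i * \<bar>?d (i - 1)\<bar> \<le> \<delta> * (real i * (R + real i) ^ card J)"
      proof (cases "i = 0")
        case False
        then have "i - 1 < c" using i c1 by (auto split: if_splits)
        then have "real i * \<bar>?d (i - 1)\<bar> \<le> real i * (\<delta> * (R + real (i - 1)) ^ card J)"
          using IH(2)[of "i - 1"] by (intro mult_left_mono) auto
        also have "\<dots> \<le> \<delta> * (real i * (R + real i) ^ card J)"
          using mult_left_mono[OF mono[of i], of \<delta>] insert.prems by (simp add: algebra_simps)
        finally show ?thesis .
      qed simp
      have 1: "\<bar>z - u\<bar> * \<bar>?d i\<bar> \<le> \<delta> * (R * (R + real i) ^ card J)"
      proof (cases "\<bar>z - u\<bar> \<le> \<delta>")
        case True
        have "\<bar>z - u\<bar> * \<bar>?d i\<bar> \<le> \<delta> * (R + real i) ^ card J"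
          using True IH(1) insert.prems by (intro mult_mono) auto
        also have "\<dots> \<le> \<delta> * (R * (R + real i) ^ card J)"
          using insert.prems nn[of i] mult_right_mono[of 1 R "(R + real i) ^ card J"]
          by (intro mult_left_mono) auto
        finally show ?thesis .
      next
        case False
        then have "i < c" using i c1 by simp
        then have "\<bar>z - u\<bar> * \<bar>?d i\<bar> \<le> R * (\<delta> * (R + real i) ^ card J)"
          using zu IH(2) insert.prems by (intro mult_mono) auto
        then show ?thesis by (simp add: algebra_simps)
      qed
      show ?thesis using step[of i] 1 2 pw[of i] by (simp add: algebra_simps)
    qed
    show ?case using A B by blast
  qed
  then show "\<bar>poly ((pderiv ^^ i) (node_poly J)) z\<bar> \<le> (R + i) ^ card J"
    and "i < card {u\<in>J. \<bar>z - u\<bar> \<le> \<delta>} \<Longrightarrow>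
      \<bar>poly ((pderiv ^^ i) (node_poly J)) z\<bar> \<le> \<delta> * (R + i) ^ card J" by auto
qed

text \<open>Roots at \<open>s\<close> are divided out: if \<open>q = (t - s) r\<close>, the
  derivative of \<open>q\<close> of order \<open>j + 1\<close> at \<open>s\<close> is
  \<open>j + 1\<close> times that of \<open>r\<close> of order \<open>j\<close>. One degree and one
  condition disappear together, until only simple nodes remain.\<close>

lemma hermite_unique:
  fixes q :: "real poly"
  assumes "finite A" "s \<notin> A" "degree q \<le> n + card A"
    and "\<And>y. y \<in> A \<Longrightarrow> poly q y = 0" "\<And>j. j \<le> n \<Longrightarrow> poly ((pderiv ^^ j) q) s = 0"
  shows "q = 0"
  using assms(3-5)
proof (induction n arbitrary: q)
  case 0
  show ?case
  proof (rule poly_eq_0_of_roots[of "insert s A"])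
    show "poly q z = 0" if "z \<in> insert s A" for z using 0(2)[of z] 0(3)[of 0] that by auto
  qed (use assms 0 in auto)
next
  case (Suc n)
  have "poly q s = 0" using Suc.prems(3)[of 0] by simp
  then obtain r where r: "q = [:- s, 1:] * r" using poly_eq_0_iff_dvd by (metis dvdE)
  have "r = 0"
  proof (rule Suc.IH)
    show "degree r \<le> n + card A"
      using Suc.prems(1) unfolding r by (cases "r = 0") (auto simp: degree_mult_eq simp del: mult_pCons_left)
    show "poly r y = 0" if "y \<in> A" for y
      using Suc.prems(2)[OF that] that assms(2) unfolding r by auto
    show "poly ((pderiv ^^ j) r) s = 0" if "j \<le> n" for j
      using Suc.prems(3)[of "Suc j"] that unfolding r poly_higher_pderiv_linear_mult by simp
  qed
  then show ?case using r by simp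
qed

text \<open>The same reduction in reverse: writing \<open>q = c 0 + (t - s) r\<close> turns the
  conditions on \<open>q\<close> into conditions on \<open>r\<close> with the data
  \<open>(g y - c 0) / (y - s)\<close> and \<open>c (j + 1) / (j + 1)\<close>.\<close>

lemma hermite_exists:
  fixes g :: "real \<Rightarrow> real" and c :: "nat \<Rightarrow> real"
  assumes "finite A" "s \<notin> A"
  shows "\<exists>q. degree q \<le> n + card A \<and> (\<forall>y\<in>A. poly q y = g y) \<and>
    (\<forall>j\<le>n. poly ((pderiv ^^ j) q) s = c j)"
proof (induction n arbitrary: g c)
  case 0
  obtain q where "degree q \<le> card (insert s A) - 1"
    and "\<forall>y\<in>insert s A. poly q y = (if y = s then c 0 else g y)"
    using ex1_lagrange_poly[of "insert s A" "\<lambda>y. if y = s then c 0 else g y"] assms by blast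
  then show ?case using assms by (intro exI[of _ q]) auto
next
  case (Suc n)
  obtain r where r: "degree r \<le> n + card A" "\<forall>y\<in>A. poly r y = (g y - c 0) / (y - s)"
    "\<forall>j\<le>n. poly ((pderiv ^^ j) r) s = c (Suc j) / real (Suc j)"
    using Suc.IH[of "\<lambda>y. (g y - c 0) / (y - s)" "\<lambda>j. c (Suc j) / real (Suc j)"] by blast
  define q where "q = [:c 0:] + [:- s, 1:] * r"
  have "degree ([:- s, 1:] * r) \<le> Suc n + card A"
    using degree_mult_le[of "[:- s, 1:]" r] r(1) by simp
  then have "degree q \<le> Suc n + card A"
    unfolding q_def by (intro degree_add_le) auto
  moreover have "poly q y = g y" if "y \<in> A" for y
  proof -
    have "y \<noteq> s" using that assms by auto
    moreover have "poly q y = c 0 + (y - s) * poly r y" by (simp add: q_def algebra_simps)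
    ultimately show ?thesis using r(2) that by simp
  qed
  moreover have "poly ((pderiv ^^ j) q) s = c j" if "j \<le> Suc n" for j
  proof (cases j)
    case 0
    then show ?thesis by (simp add: q_def)
  next
    case (Suc l)
    show ?thesis
      using higher_pderiv_const[of l "c 0"] r(3) that unfolding q_def higher_pderiv_add poly_add Suc poly_higher_pderiv_linear_mult
      by simp
  qed
  ultimately show ?case by blast
qed

text \<open>The \<open>h j\<close> are the part of the Hermite basis that belongs to
  \<open>s\<close>. They depend only on the nodes, so small derivatives of \<open>D\<close> at
  \<open>s\<close> make every derivative of \<open>D\<close> small at every point, with constants
  fixed before \<open>D\<close>.\<close>

lemma hermite_expansion:
  fixes A :: "real set" and s :: real
  assumes "finite A" "s \<notin> A"
  obtains h :: "nat \<Rightarrow> real poly" where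
    "\<And>D. degree D \<le> n + card A \<Longrightarrow> (\<And>y. y \<in> A \<Longrightarrow> poly D y = 0) \<Longrightarrow>
      D = (\<Sum>j\<le>n. smult (poly ((pderiv ^^ j) D) s) (h j))"
proof -
  have "\<exists>q. degree q \<le> n + card A \<and> (\<forall>y\<in>A. poly q y = 0) \<and>
    (\<forall>j\<le>n. poly ((pderiv ^^ j) q) s = (if j = i then 1 else 0))" for i
    using hermite_exists[OF assms, of n "\<lambda>_. 0" "\<lambda>j. if j = i then 1 else 0"] by simp
  then obtain h where h: "\<And>i. degree (h i) \<le> n + card A" "\<And>i y. y \<in> A \<Longrightarrow> poly (h i) y = 0"
    "\<And>i j. j \<le> n \<Longrightarrow> poly ((pderiv ^^ j) (h i)) s = (if j = i then 1 else 0)"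
    by metis
  show thesis
  proof (rule that[of h])
    fix D :: "real poly" assume D: "degree D \<le> n + card A" "\<And>y. y \<in> A \<Longrightarrow> poly D y = 0"
    let ?q = "\<Sum>j\<le>n. smult (poly ((pderiv ^^ j) D) s) (h j)"
    have "D - ?q = 0"
    proof (rule hermite_unique[OF assms])
      have "degree ?q \<le> n + card A"
        using h(1) by (intro degree_sum_le) (auto intro: order.trans[OF degree_smult_le])
      then show "degree (D - ?q) \<le> n + card A" using D by (intro degree_diff_le) auto
      show "poly (D - ?q) y = 0" if "y \<in> A" for y using that D h by (simp add: poly_sum)
      show "poly ((pderiv ^^ j) (D - ?q)) s = 0" if "j \<le> n" for j
      proof -
        have "poly ((pderiv ^^ j) ?q) s =
          (\<Sum>i\<le>n. poly ((pderiv ^^ i) D) s * poly ((pderiv ^^ j) (h i)) s)"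
          by (simp add: higher_pderiv_sum higher_pderiv_smult poly_sum)
        also have "\<dots> = (\<Sum>i\<le>n. if i = j then poly ((pderiv ^^ j) D) s else 0)"
          using that h(3) by (intro sum.cong) auto
        also have "\<dots> = poly ((pderiv ^^ j) D) s" using that by simp
        finally show ?thesis by (simp add: higher_pderiv_diff)
      qed
    qed
    then show "D = ?q" by simp
  qed
qed

section \<open>Convergence of Lagrange polynomials\<close>

text \<open>The left side is what an exchange of two nodes of \<open>U\<close> can cost, since their
  distance is at most \<open>diameter U\<close>. For \<open>\<alpha> > 0\<close> it tends to
  \<open>0\<close> with the diameter; this is all that is used of the norm afterwards.\<close>

definition divided_diff_bound ::
    "nat \<Rightarrow> (real \<Rightarrow> real) \<Rightarrow> real set \<Rightarrow> real \<Rightarrow> real \<Rightarrow> bool" where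
  "divided_diff_bound m f E C \<alpha> \<longleftrightarrow>
    (\<forall>U. finite U \<and> U \<subseteq> E \<and> card U = m + 1 \<longrightarrow>
      \<bar>divided_diff m f U\<bar> * diameter U \<le> C * diameter U powr \<alpha>)"

lemma abs_diff_le_diameter:
  fixes U :: "real set"
  assumes "finite U" "u \<in> U" "v \<in> U"
  shows "\<bar>u - v\<bar> \<le> diameter U"
  using diameter_bounded_bound[OF finite_imp_bounded[OF assms(1)] assms(2,3)] by (simp add: dist_real_def)

lemma diameter_nonneg: "finite (U :: real set) \<Longrightarrow> 0 \<le> diameter U"
  by (simp add: diameter_ge_0 finite_imp_bounded)

lemma finite_strict_mono_enumeration:
  fixes U :: "real set"
  assumes "finite U"
  obtains v where "strict_mono_on {..<card U} v" "v ` {..<card U} = U"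
proof
  let ?v = "\<lambda>i. sorted_list_of_set U ! i"
  show "strict_mono_on {..<card U} ?v"
    using strict_sorted_list_of_set[of U] by (auto simp: strict_mono_on_def sorted_wrt_iff_nth_less)
  have "?v ` {..<card U} = set (sorted_list_of_set U)"
    by (auto simp: set_conv_nth image_def simp flip: length_sorted_list_of_set simp del: set_sorted_list_of_set)
  then show "?v ` {..<card U} = U" using assms by simp
qed

text \<open>For \<open>n = m\<close> the sum in the norm has a single term. Its \<open>p\<close>-th
  root bounds the divided difference times \<open>diameter U powr (1 / p)\<close>, and the remaining
  power of the diameter goes to the right side.\<close>

lemma variational_norm_divided_diff_bound:
  assumes "variational_norm m p f E < \<infinity>" "1 < p"
  obtains C where "0 \<le> C" "divided_diff_bound m f E C (1 - 1 / p)"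
proof -
  define C where "C = enn2real (variational_norm m p f E)"
  have C: "variational_norm m p f E = ennreal C"
    unfolding C_def using assms(1) by (simp add: less_top)
  have C0: "0 \<le> C" by (simp add: C_def)
  have "\<bar>divided_diff m f U\<bar> * diameter U \<le> C * diameter U powr (1 - 1 / p)"
    if U: "finite U" "U \<subseteq> E" "card U = m + 1" for U
  proof (cases "diameter U = 0")
    case True
    then show ?thesis by simp
  next
    case False
    then have D0: "0 < diameter U" using diameter_nonneg[OF U(1)] by linarith
    obtain x where x: "strict_mono_on {..<card U} x" "x ` {..<card U} = U"
      using finite_strict_mono_enumeration[OF U(1)] by blast
    have "{..<card U} = {0..m}" using U(3) by auto
    then have mono: "strict_mono_on {0..m} x" and img: "x ` {0..m} = U" using x by simp_all
    have bnd: "x 0 \<le> u \<and> u \<le> x m" if u: "u \<in> U" for u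
    proof -
      obtain i where i: "u = x i" "i \<le> m" using u img by auto
      have "mono_on {0..m} x" using mono by (rule strict_mono_on_imp_mono_on)
      then show ?thesis using i by (auto simp: mono_on_def)
    qed
    have D: "diameter U \<le> x m - x 0"
    proof (rule diameter_le)
      show "U \<noteq> {} \<or> 0 \<le> x m - x 0" using U by auto
      fix u v assume "u \<in> U" "v \<in> U"
      then show "norm (u - v) \<le> x m - x 0" using bnd[of u] bnd[of v] by auto
    qed
    let ?\<Delta> = "\<bar>divided_diff m f U\<bar>"
    have "ennreal ((\<Sum>i = 0..m - m. (x (i + m) - x i) *
                   \<bar>divided_diff m f (x ` {i..i + m})\<bar> powr p) powr (1 / p)) \<le> variational_norm m p f E"
      unfolding variational_norm_def
      using mono img U(2) by (intro SUP_upper2[of "(m, x)"]) auto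
    then have "((x m - x 0) * ?\<Delta> powr p) powr (1 / p) \<le> C"
      unfolding C by (simp add: img C0)
    moreover have "(diameter U * ?\<Delta> powr p) powr (1 / p) \<le> ((x m - x 0) * ?\<Delta> powr p) powr (1 / p)"
      using D D0 assms(2) by (intro powr_mono2 mult_right_mono mult_nonneg_nonneg) auto
    moreover have "(diameter U * ?\<Delta> powr p) powr (1 / p) = diameter U powr (1 / p) * ?\<Delta>"
      using D0 assms(2) by (simp add: powr_mult powr_powr)
    ultimately have *: "diameter U powr (1 / p) * ?\<Delta> \<le> C" by linarith
    have "?\<Delta> * diameter U = (diameter U powr (1 / p) * ?\<Delta>) * diameter U powr (1 - 1 / p)"
      using D0 by (simp add: mult.commute mult.left_commute flip: powr_add)
    also have "\<dots> \<le> C * diameter U powr (1 - 1 / p)"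
      using * by (rule mult_right_mono) simp
    finally show ?thesis .
  qed
  then have "divided_diff_bound m f E C (1 - 1 / p)" unfolding divided_diff_bound_def by blast
  with C0 show thesis using that by blast
qed

text \<open>The points of \<open>A - B\<close> are exchanged for those of \<open>B - A\<close> one at a time.\<close>

lemma lagrange_poly_deriv_diff:
  assumes bd: "divided_diff_bound m f E C \<alpha>" and "0 \<le> C" "0 \<le> \<alpha>"
    and "finite A" "finite B" "A \<subseteq> E" "B \<subseteq> E" "card A = m" "card B = m"
    and "\<And>u v. u \<in> A \<union> B \<Longrightarrow> v \<in> A \<union> B \<Longrightarrow> \<bar>u - v\<bar> \<le> D"
    and "\<And>J. finite J \<Longrightarrow> card J + 1 = m \<Longrightarrow> A \<inter> B \<subseteq> J \<Longrightarrow> J \<subseteq> A \<union> B \<Longrightarrow>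
      \<bar>poly ((pderiv ^^ i) (node_poly J)) z\<bar> \<le> M"
  shows "\<bar>poly ((pderiv ^^ i) (lagrange_poly A f)) z - poly ((pderiv ^^ i) (lagrange_poly B f)) z\<bar>
    \<le> real (card (A - B)) * (C * D powr \<alpha> * M)"
  using assms(4-)
\<comment> \<open>Every exchange enlarges \<open>A \<inter> B\<close> and shrinks
  \<open>A \<union> B\<close>, so the bounds \<open>D\<close> and \<open>M\<close> pass on to the
  next \<open>A\<close>.\<close>
proof (induction "card (A - B)" arbitrary: A)
  case 0
  then have "A \<subseteq> B" by simp
  then have "A = B" using 0 card_subset_eq[of B A] by simp
  then show ?case by simp
next
  case (Suc k)
  have cBA: "card (B - A) = Suc k"
    using card_Diff_subset_Int[of A B] card_Diff_subset_Int[of B A] Suc by (simp add: Int_commute)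
  obtain a b where a: "a \<in> A" "a \<notin> B" and b: "b \<in> B" "b \<notin> A"
    using Suc.hyps(2) cBA by (metis DiffE card_eq_0_iff ex_in_conv nat.distinct(1))
  define J where "J = A - {a}"
  have J: "finite J" "a \<notin> J" "b \<notin> J" "a \<noteq> b" "A = insert a J" using a b Suc by (auto simp: J_def)
  have cJ: "card J + 1 = m" using Suc.prems J by auto
  define U where "U = insert a (insert b J)"
  have U: "finite U" "U \<subseteq> E" "card U = m + 1" "U \<subseteq> A \<union> B"
    using J cJ Suc.prems a b by (auto simp: U_def)
  have dU: "diameter U \<le> D"
    using Suc.prems(7) U(4) by (intro diameter_le) (auto simp: U_def)
  have D0: "0 \<le> D" using dU diameter_nonneg[OF U(1)] by linarith
  have M: "\<bar>poly ((pderiv ^^ i) (node_poly J)) z\<bar> \<le> M"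
    using J a b cJ by (intro Suc.prems(8)) auto
  have "\<bar>divided_diff m f U * (a - b)\<bar> \<le> \<bar>divided_diff m f U\<bar> * diameter U"
    using abs_diff_le_diameter[OF U(1), of a b]
    by (auto simp: abs_mult U_def intro: mult_left_mono)
  also have "\<dots> \<le> C * diameter U powr \<alpha>"
    using bd U unfolding divided_diff_bound_def by blast
  also have "\<dots> \<le> C * D powr \<alpha>"
    using assms(2,3) dU diameter_nonneg[OF U(1)] by (intro mult_left_mono powr_mono2) auto
  finally have c: "\<bar>divided_diff m f U * (a - b)\<bar> \<le> C * D powr \<alpha>" .
  have "poly ((pderiv ^^ i) (lagrange_poly A f)) z - poly ((pderiv ^^ i) (lagrange_poly (insert b J) f)) z
     = divided_diff m f U * (a - b) * poly ((pderiv ^^ i) (node_poly J)) z"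
    using arg_cong[OF lagrange_poly_exchange[OF J(1-4), of f], of "\<lambda>q. poly ((pderiv ^^ i) q) z"]
    by (simp add: J(5)[symmetric] higher_pderiv_diff higher_pderiv_smult U_def cJ[simplified])
  then have 1: "\<bar>poly ((pderiv ^^ i) (lagrange_poly A f)) z - poly ((pderiv ^^ i) (lagrange_poly (insert b J) f)) z\<bar>
     \<le> C * D powr \<alpha> * M"
    using c M assms(2) by (simp add: abs_mult mult_mono del: abs_mult_self_eq)
  have diff: "insert b J - B = (A - B) - {a}" using b J by auto
  have "k = card (insert b J - B)"
    unfolding diff using Suc.hyps(2) a Suc.prems(1) by simp
  then have "\<bar>poly ((pderiv ^^ i) (lagrange_poly (insert b J) f)) z - poly ((pderiv ^^ i) (lagrange_poly B f)) z\<bar>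
      \<le> real (card (insert b J - B)) * (C * D powr \<alpha> * M)"
  proof (rule Suc.hyps(1))
    show "\<bar>u - v\<bar> \<le> D" if "u \<in> insert b J \<union> B" "v \<in> insert b J \<union> B" for u v
      using that Suc.prems(7) b J(5) by auto
    show "\<bar>poly ((pderiv ^^ i) (node_poly J')) z\<bar> \<le> M"
      if "finite J'" "card J' + 1 = m" "insert b J \<inter> B \<subseteq> J'" "J' \<subseteq> insert b J \<union> B" for J'
      using that a b J by (intro Suc.prems(8)) auto
  qed (use Suc.prems J b cJ in auto)
  then show ?case
    using 1 \<open>k = card (insert b J - B)\<close> Suc.hyps(2) by (simp add: algebra_simps flip: Suc.hyps(2))
qed

section \<open>Limits along sets shrinking to a limit point\<close>

lemma eventually_sets_to:
  "eventually Q (sets_to m E z) \<longleftrightarrow>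
    (\<exists>\<delta>>0. \<forall>S. finite S \<longrightarrow> S \<subseteq> E \<longrightarrow> card S = m \<longrightarrow> (\<forall>u\<in>S. \<bar>u - z\<bar> < \<delta>) \<longrightarrow> Q S)"
  (is "?l \<longleftrightarrow> ?r")
proof
  assume ?l
  then obtain R where R: "eventually R (nhds (0 :: real))"
    "\<And>S. R (diameter (insert z S)) \<Longrightarrow> finite S \<Longrightarrow> S \<subseteq> E \<Longrightarrow> card S = m \<Longrightarrow> Q S"
    unfolding sets_to_def eventually_inf_principal eventually_filtercomap by auto
  then obtain d where d: "d > 0" "\<And>t. \<bar>t\<bar> < d \<Longrightarrow> R t"
    unfolding eventually_nhds_metric by auto
  have "Q S" if S: "finite S" "S \<subseteq> E" "card S = m" "\<forall>u\<in>S. \<bar>u - z\<bar> < d / 4" for S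
  proof (rule R(2)[OF d(2) S(1-3)])
    have "diameter (insert z S) \<le> d / 2"
    proof (rule diameter_le)
      fix u v assume "u \<in> insert z S" "v \<in> insert z S"
      then have "\<bar>u - z\<bar> < d / 4" "\<bar>v - z\<bar> < d / 4" using S(4) d(1) by auto
      then show "norm (u - v) \<le> d / 2" by (simp add: abs_if split: if_splits)
    qed simp
    then show "\<bar>diameter (insert z S)\<bar> < d"
      using d(1) diameter_nonneg[of "insert z S"] S(1) by simp
  qed
  then show ?r using d(1) by (intro exI[of _ "d / 4"]) auto
next
  assume ?r
  then obtain d where d: "d > 0"
    "\<And>S. finite S \<Longrightarrow> S \<subseteq> E \<Longrightarrow> card S = m \<Longrightarrow> (\<forall>u\<in>S. \<bar>u - z\<bar> < d) \<Longrightarrow> Q S" by blast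
  have "eventually (\<lambda>t. t < d) (nhds (0 :: real))"
    using d(1) by (intro order_tendstoD(2)[of "\<lambda>t. t" 0]) (auto simp: filterlim_ident)
  moreover have "Q S" if S: "diameter (insert z S) < d" "finite S" "S \<subseteq> E" "card S = m" for S
    using S abs_diff_le_diameter[of "insert z S" _ z] by (intro d(2)) (auto intro: le_less_trans)
  ultimately show ?l
    unfolding sets_to_def eventually_inf_principal eventually_filtercomap by blast
qed

lemma islimpt_superset_near:
  fixes z :: real
  assumes "z islimpt E" "0 < \<delta>" "finite B" "B \<subseteq> E" "\<And>u. u \<in> B \<Longrightarrow> \<bar>u - z\<bar> < \<delta>" "card B \<le> m"
  obtains T where "B \<subseteq> T" "finite T" "T \<subseteq> E" "card T = m" "\<And>u. u \<in> T \<Longrightarrow> \<bar>u - z\<bar> < \<delta>"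
proof -
  have "infinite (E \<inter> ball z \<delta> - B)"
    using assms(1-3) islimpt_eq_infinite_ball by (metis Diff_infinite_finite)
  from infinite_arbitrarily_large[OF this, of "m - card B"] obtain K where
    K: "finite K" "card K = m - card B" "K \<subseteq> E \<inter> ball z \<delta> - B" by blast
  show thesis
  proof (rule that[of "B \<union> K"])
    show "card (B \<union> K) = m" using K assms by (subst card_Un_disjoint) auto
    show "\<bar>u - z\<bar> < \<delta>" if "u \<in> B \<union> K" for u
      using that K(3) assms(5) by (auto simp: dist_real_def abs_minus_commute)
  qed (use K assms in auto)
qed

text \<open>\<open>Lim\<close> is a definite description; convergence determines it only over a
  proper filter.\<close>

lemma sets_to_neq_bot:
  assumes "z islimpt E"
  shows "sets_to m E z \<noteq> bot"
proof
  assume "sets_to m E z = bot"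
  then have "eventually (\<lambda>_. False) (sets_to m E z)" by simp
  then obtain d where d: "d > 0"
    "\<And>S. finite S \<Longrightarrow> S \<subseteq> E \<Longrightarrow> card S = m \<Longrightarrow> (\<forall>u\<in>S. \<bar>u - z\<bar> < d) \<Longrightarrow> False"
    unfolding eventually_sets_to by blast
  obtain T where "finite T" "T \<subseteq> E" "card T = m" "\<And>u. u \<in> T \<Longrightarrow> \<bar>u - z\<bar> < d"
    by (rule islimpt_superset_near[OF assms d(1), of "{}" m]) auto
  then show False using d(2)[of T] by blast
qed

text \<open>No candidate for the limit is at hand, so completeness is used: two
  \<open>m\<close>-point sets within \<open>d\<close> of \<open>z\<close> are joined by at most
  \<open>m\<close> exchanges, each costing a constant times
  \<open>(2 * d) powr \<alpha>\<close>.\<close>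

lemma tendsto_limit_deriv:
  assumes bd: "divided_diff_bound m f E C \<alpha>" and C: "0 \<le> C" and \<alpha>: "0 < \<alpha>" and z: "z islimpt E"
  shows "((\<lambda>S. poly ((pderiv ^^ i) (lagrange_poly S f)) z) \<longlongrightarrow> limit_deriv m E f i z) (sets_to m E z)"
proof -
  let ?g = "\<lambda>S. poly ((pderiv ^^ i) (lagrange_poly S f)) z"
  define K where "K = real m * (C * (1 + real i) ^ (m - 1))"
  have K: "0 \<le> K" using C by (simp add: K_def)
  have "\<exists>P. eventually P (sets_to m E z) \<and> (\<forall>A B. P A \<and> P B \<longrightarrow> dist (?g A) (?g B) < e)" if e: "e > 0" for e
  proof -
    \<comment> \<open>Chosen so that \<open>K * (2 * d) powr \<alpha> < e\<close>, where
      \<open>K + 1\<close> avoids a division by zero; \<open>d \<le> 1\<close> permits the radius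
      \<open>1\<close> in the node bound.\<close>
    define d where "d = min 1 ((e / (K + 1)) powr (1 / \<alpha>) / 2)"
    have d: "0 < d" "d \<le> 1" "2 * d \<le> (e / (K + 1)) powr (1 / \<alpha>)" using e K by (auto simp: d_def)
    have "(2 * d) powr \<alpha> \<le> ((e / (K + 1)) powr (1 / \<alpha>)) powr \<alpha>"
      using d \<alpha> by (intro powr_mono2) auto
    also have "\<dots> = e / (K + 1)" using e K \<alpha> by (simp add: powr_powr)
    finally have "K * (2 * d) powr \<alpha> \<le> K * (e / (K + 1))" using K by (rule mult_left_mono)
    also have "\<dots> < e" using e K by (simp add: field_simps)
    finally have Kd: "K * (2 * d) powr \<alpha> < e" .
    define P where "P S \<longleftrightarrow> finite S \<and> S \<subseteq> E \<and> card S = m \<and> (\<forall>u\<in>S. \<bar>u - z\<bar> < d)" for S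
    have "eventually P (sets_to m E z)"
      unfolding eventually_sets_to P_def using d(1) by blast
    moreover have "dist (?g A) (?g B) < e" if A: "P A" and B: "P B" for A B
    proof -
      have near: "\<bar>u - z\<bar> < d" if "u \<in> A \<union> B" for u using that A B by (auto simp: P_def)
      have "\<bar>?g A - ?g B\<bar> \<le> real (card (A - B)) * (C * (2 * d) powr \<alpha> * (1 + real i) ^ (m - 1))"
      proof (rule lagrange_poly_deriv_diff[OF bd C])
        show "\<bar>u - v\<bar> \<le> 2 * d" if "u \<in> A \<union> B" "v \<in> A \<union> B" for u v
          using near[OF that(1)] near[OF that(2)] by linarith
        show "\<bar>poly ((pderiv ^^ i) (node_poly J)) z\<bar> \<le> (1 + real i) ^ (m - 1)"
          if "finite J" "card J + 1 = m" "J \<subseteq> A \<union> B" for J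
        proof -
          have "\<bar>z - u\<bar> \<le> 1" if "u \<in> J" for u
            using near[of u] that \<open>J \<subseteq> A \<union> B\<close> d(2) by (auto simp: abs_minus_commute)
          from node_poly_deriv_bound(1)[OF \<open>finite J\<close> this, of 1 i] show ?thesis
            using that(2) by auto
        qed
      qed (use A B \<alpha> in \<open>auto simp: P_def\<close>)
      also have "\<dots> \<le> real m * (C * (2 * d) powr \<alpha> * (1 + real i) ^ (m - 1))"
        using A C card_mono[of A "A - B"] by (intro mult_right_mono) (auto simp: P_def)
      also have "\<dots> = K * (2 * d) powr \<alpha>" by (simp add: K_def)
      finally show ?thesis using Kd by (simp add: dist_real_def)
    qed
    ultimately show ?thesis by blast
  qed
  then have "cauchy_filter (filtermap ?g (sets_to m E z))"
    unfolding cauchy_filter_metric_filtermap by blast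
  moreover have ne: "sets_to m E z \<noteq> bot" by (rule sets_to_neq_bot[OF z])
  moreover have "complete (UNIV :: real set)" by (rule complete_UNIV)
  ultimately obtain c where "(?g \<longlongrightarrow> c) (sets_to m E z)"
    using cauchy_filter_complete_converges[of "filtermap ?g (sets_to m E z)" UNIV]
    by (auto simp: filterlim_def filtermap_bot_iff)
  moreover from this have "limit_deriv m E f i z = c"
    unfolding limit_deriv_def by (rule tendsto_Lim[OF ne])
  ultimately show ?thesis by simp
qed

text \<open>This makes the description in \<open>whitney_field\<close> well defined. The value at
  \<open>s\<close> counts as a derivative of order \<open>0\<close>, so \<open>s\<close> is a node
  of multiplicity \<open>n + 1\<close>.\<close>

lemma hermite_ex1:
  fixes S :: "real set"
  assumes "finite S" "s \<in> S"
  shows "\<exists>!q. degree q \<le> card S - 1 + n \<and> (\<forall>y\<in>S. poly q y = f y) \<and>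
    (\<forall>j\<in>{1..n}. poly ((pderiv ^^ j) q) s = c j)"
proof -
  have c: "n + card (S - {s}) = card S - 1 + n" using assms by simp
  show ?thesis
  proof (rule ex_ex1I)
    obtain q where q: "degree q \<le> n + card (S - {s})" "\<forall>y\<in>S - {s}. poly q y = f y"
      "\<forall>j\<le>n. poly ((pderiv ^^ j) q) s = (if j = 0 then f s else c j)"
      using hermite_exists[of "S - {s}" s n f "\<lambda>j. if j = 0 then f s else c j"] assms(1) by blast
    have "poly q y = f y" if "y \<in> S" for y
      using q(2) q(3)[rule_format, of 0] that by (cases "y = s") auto
    then show "\<exists>q. degree q \<le> card S - 1 + n \<and> (\<forall>y\<in>S. poly q y = f y) \<and>
      (\<forall>j\<in>{1..n}. poly ((pderiv ^^ j) q) s = c j)"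
      using q c by (intro exI[of _ q]) auto
  next
    fix q r :: "real poly"
    assume q: "degree q \<le> card S - 1 + n \<and> (\<forall>y\<in>S. poly q y = f y) \<and>
        (\<forall>j\<in>{1..n}. poly ((pderiv ^^ j) q) s = c j)"
      and r: "degree r \<le> card S - 1 + n \<and> (\<forall>y\<in>S. poly r y = f y) \<and>
        (\<forall>j\<in>{1..n}. poly ((pderiv ^^ j) r) s = c j)"
    have "q - r = 0"
    proof (rule hermite_unique[of "S - {s}" s _ n])
      show "poly ((pderiv ^^ j) (q - r)) s = 0" if "j \<le> n" for j
        using that q r assms by (cases "j = 0") (auto simp: higher_pderiv_diff)
      show "degree (q - r) \<le> n + card (S - {s})"
        unfolding c using q r by (intro degree_diff_le) auto
    qed (use q r assms in auto)
    then show "q = r" by simp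
  qed
qed

text \<open>The diameter of \<open>S \<union> N\<close> need not shrink, so the divided differences
  contribute only a bounded factor. Smallness comes from the node polynomials: every intermediate
  node set contains \<open>insert s N\<close>, that is \<open>n + 1\<close> nodes near
  \<open>s\<close>, and differentiating \<open>j \<le> n\<close> times leaves a small factor. The
  set \<open>T\<close> reached in this way lies close to \<open>s\<close>, where the limit takes
  over.\<close>

lemma hermite_deriv_approx:
  assumes bd: "divided_diff_bound m f E C \<alpha>" and C: "0 \<le> C" and \<alpha>: "0 < \<alpha>" and s: "s islimpt E"
    and S: "finite S" "S \<subseteq> E" "s \<in> S" "card S + n = m" and j: "j \<le> n" and \<eta>: "0 < \<eta>"
  shows "\<forall>\<^sub>F \<delta> in at_right 0. \<forall>N. finite N \<longrightarrow> N \<subseteq> E \<longrightarrow> N \<inter> S = {} \<longrightarrow> card N = n \<longrightarrow>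
    (\<forall>u\<in>N. \<bar>u - s\<bar> < \<delta>) \<longrightarrow>
    \<bar>poly ((pderiv ^^ j) (lagrange_poly (S \<union> N) f)) s - limit_deriv m E f j s\<bar> < \<eta>"
proof -
  define R where "R = 1 + (\<Sum>u\<in>S. \<bar>u - s\<bar>)"
  have R: "1 \<le> R" "\<And>u. u \<in> S \<Longrightarrow> \<bar>u - s\<bar> \<le> R"
    using S(1) member_le_sum[of _ S "\<lambda>u. \<bar>u - s\<bar>"] by (force simp: R_def sum_nonneg)+
  define K where "K = real m * (C * (2 * R) powr \<alpha> * (R + real j) ^ (m - 1))"
  have K: "0 \<le> K" using C R(1) by (simp add: K_def)
  have "eventually (\<lambda>T. dist (poly ((pderiv ^^ j) (lagrange_poly T f)) s) (limit_deriv m E f j s) < \<eta> / 2)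
      (sets_to m E s)"
    by (rule tendstoD[OF tendsto_limit_deriv[OF bd C \<alpha> s] half_gt_zero[OF \<eta>]])
  then obtain d where d: "0 < d"
    "\<And>T. finite T \<Longrightarrow> T \<subseteq> E \<Longrightarrow> card T = m \<Longrightarrow> (\<forall>u\<in>T. \<bar>u - s\<bar> < d) \<Longrightarrow>
      \<bar>poly ((pderiv ^^ j) (lagrange_poly T f)) s - limit_deriv m E f j s\<bar> < \<eta> / 2"
    unfolding eventually_sets_to dist_real_def by blast
  \<comment> \<open>One half of \<open>\<eta>\<close> is for the passage from
    \<open>S \<union> N\<close> to \<open>T\<close>, the other for the distance of \<open>T\<close>
    from the limit.\<close>
  define b where "b = min d (min 1 (\<eta> / (2 * (K + 1))))"
  have b: "0 < b" using d \<eta> K by (simp add: b_def)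
  have "\<bar>poly ((pderiv ^^ j) (lagrange_poly (S \<union> N) f)) s - limit_deriv m E f j s\<bar> < \<eta>"
    if \<delta>: "0 < \<delta>" "\<delta> < b" and N: "finite N" "N \<subseteq> E" "N \<inter> S = {}" "card N = n" "\<forall>u\<in>N. \<bar>u - s\<bar> < \<delta>" for \<delta> N
  proof -
    have \<delta>': "\<delta> < d" "\<delta> \<le> 1" "\<delta> < \<eta> / (2 * (K + 1))" using \<delta> by (auto simp: b_def)
    have "s \<notin> N" using N(3) S(3) by blast
    then have sN: "card (insert s N) = n + 1" using N by simp
    have "0 < card S" using S by (auto simp: card_gt_0_iff)
    then have cm: "card (insert s N) \<le> m" using sN S(4) by linarith
    obtain T where T: "insert s N \<subseteq> T" "finite T" "T \<subseteq> E" "card T = m" "\<And>u. u \<in> T \<Longrightarrow> \<bar>u - s\<bar> < \<delta>"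
    proof (rule islimpt_superset_near[OF s \<delta>(1) _ _ _ cm])
      show "\<bar>u - s\<bar> < \<delta>" if "u \<in> insert s N" for u using that N(5) \<delta>(1) by auto
    qed (use N S in auto)
    let ?H = "S \<union> N"
    have H: "finite ?H" "?H \<subseteq> E" "card ?H = m"
      using N S by (auto simp: card_Un_disjoint Int_commute)
    have near: "\<bar>u - s\<bar> \<le> R" if "u \<in> ?H \<union> T" for u
      using that N(5) T(5)[of u] R \<delta>' by force
    have "\<bar>poly ((pderiv ^^ j) (lagrange_poly ?H f)) s - poly ((pderiv ^^ j) (lagrange_poly T f)) s\<bar>
      \<le> real (card (?H - T)) * (C * (2 * R) powr \<alpha> * (\<delta> * (R + real j) ^ (m - 1)))"
    proof (rule lagrange_poly_deriv_diff[OF bd C])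
      show "\<bar>u - v\<bar> \<le> 2 * R" if "u \<in> ?H \<union> T" "v \<in> ?H \<union> T" for u v
        using near[OF that(1)] near[OF that(2)] by linarith
      show "\<bar>poly ((pderiv ^^ j) (node_poly J)) s\<bar> \<le> \<delta> * (R + real j) ^ (m - 1)"
        if J: "finite J" "card J + 1 = m" "?H \<inter> T \<subseteq> J" "J \<subseteq> ?H \<union> T" for J
      proof -
        have "insert s N \<subseteq> {u\<in>J. \<bar>s - u\<bar> \<le> \<delta>}"
          using J(3) T(1) N(5) S(3) \<delta>(1) by (auto simp: abs_minus_commute less_imp_le)
        then have "n + 1 \<le> card {u\<in>J. \<bar>s - u\<bar> \<le> \<delta>}"
          using sN J(1) card_mono[of "{u\<in>J. \<bar>s - u\<bar> \<le> \<delta>}" "insert s N"] by auto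
        then have "\<bar>poly ((pderiv ^^ j) (node_poly J)) s\<bar> \<le> \<delta> * (R + real j) ^ card J"
          using J near j R(1) \<delta>(1) \<delta>'(2)
          by (intro node_poly_deriv_bound(2)) (auto simp: abs_minus_commute subset_eq)
        moreover have "card J = m - 1" using J(2) by simp
        ultimately show ?thesis by simp
      qed
    qed (use H T \<alpha> in auto)
    also have "\<dots> \<le> real m * (C * (2 * R) powr \<alpha> * (\<delta> * (R + real j) ^ (m - 1)))"
      using H C R(1) \<delta>(1) card_mono[of ?H "?H - T"] by (intro mult_right_mono) auto
    also have "\<dots> = K * \<delta>" by (simp add: K_def)
    also have "\<dots> \<le> K * (\<eta> / (2 * (K + 1)))" using K \<delta>'(3) by (intro mult_left_mono) auto
    also have "\<dots> \<le> \<eta> / 2" using K \<eta> by (simp add: field_simps)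
    finally have "\<bar>poly ((pderiv ^^ j) (lagrange_poly ?H f)) s - poly ((pderiv ^^ j) (lagrange_poly T f)) s\<bar> \<le> \<eta> / 2" .
    moreover have "\<bar>poly ((pderiv ^^ j) (lagrange_poly T f)) s - limit_deriv m E f j s\<bar> < \<eta> / 2"
      using T(5) \<delta>'(1) by (intro d(2) T) force
    ultimately show ?thesis by linarith
  qed
  then show ?thesis unfolding eventually_at_right_field using b by blast
qed

text \<open>The error vanishes on \<open>S\<close>, so the Hermite basis expresses it through its
  derivatives of orders \<open>1\<close> to \<open>n\<close> at \<open>s\<close>. These are small:
  there \<open>P\<close> takes the limits as its data, and the Lagrange polynomial is close to
  them.\<close>

lemma hermite_approx:
  assumes bd: "divided_diff_bound m f E C \<alpha>" and C: "0 \<le> C" and \<alpha>: "0 < \<alpha>" and s: "s islimpt E"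
    and S: "finite S" "S \<subseteq> E" "s \<in> S" "card S + n = m" and \<epsilon>: "0 < \<epsilon>"
    and P: "degree P \<le> m - 1" "\<And>y. y \<in> S \<Longrightarrow> poly P y = f y"
      "\<And>j. j \<in> {1..n} \<Longrightarrow> poly ((pderiv ^^ j) P) s = limit_deriv m E f j s"
  shows "\<forall>\<^sub>F \<delta> in at_right 0. \<forall>N. finite N \<longrightarrow> N \<subseteq> E \<longrightarrow> N \<inter> S = {} \<longrightarrow> card N = n \<longrightarrow>
    (\<forall>u\<in>N. \<bar>u - s\<bar> < \<delta>) \<longrightarrow>
    \<bar>poly ((pderiv ^^ i) P) y - poly ((pderiv ^^ i) (lagrange_poly (S \<union> N) f)) y\<bar> < \<epsilon>"
proof -
  have cS: "0 < card S" using S by (auto simp: card_gt_0_iff)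
  \<comment> \<open>The node \<open>s\<close> has multiplicity \<open>n + 1\<close> and the others
    are simple, \<open>m\<close> conditions in all.\<close>
  then have cSm: "n + card (S - {s}) = m - 1" using S by simp
  obtain h where h: "\<And>D. degree D \<le> m - 1 \<Longrightarrow> (\<And>y. y \<in> S - {s} \<Longrightarrow> poly D y = 0) \<Longrightarrow>
      D = (\<Sum>j\<le>n. smult (poly ((pderiv ^^ j) D) s) (h j))"
    using hermite_expansion[of "S - {s}" s n] S(1) unfolding cSm by blast
  define B where "B = (\<Sum>j\<le>n. \<bar>poly ((pderiv ^^ i) (h j)) y\<bar>)"
  have B: "0 \<le> B" by (simp add: B_def sum_nonneg)
  define \<eta> where "\<eta> = \<epsilon> / (B + 1)"
  have \<eta>: "0 < \<eta>" "\<eta> * B < \<epsilon>" using \<epsilon> B by (auto simp: \<eta>_def field_simps)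
  have "\<forall>\<^sub>F \<delta> in at_right 0. \<forall>j\<in>{1..n}. \<forall>N. finite N \<longrightarrow> N \<subseteq> E \<longrightarrow> N \<inter> S = {} \<longrightarrow> card N = n \<longrightarrow>
    (\<forall>u\<in>N. \<bar>u - s\<bar> < \<delta>) \<longrightarrow>
    \<bar>poly ((pderiv ^^ j) (lagrange_poly (S \<union> N) f)) s - limit_deriv m E f j s\<bar> < \<eta>"
    using hermite_deriv_approx[OF bd C \<alpha> s S _ \<eta>(1)] by (intro eventually_ball_finite ballI) auto
  then show ?thesis
  proof (eventually_elim, intro allI impI, goal_cases)
    case (1 \<delta> N)
    define D where "D = P - lagrange_poly (S \<union> N) f"
    have fin: "finite (S \<union> N)" "S \<union> N \<noteq> {}" "card (S \<union> N) = m"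
      using 1 S by (auto simp: card_Un_disjoint Int_commute)
    have D0: "poly D z = 0" if "z \<in> S" for z
      using that P(2) poly_lagrange_poly[OF fin(1,2)] by (simp add: D_def)
    have "degree D \<le> m - 1"
      unfolding D_def using P(1) degree_lagrange_poly[OF fin(1,2)] fin(3) by (intro degree_diff_le) auto
    then have D: "D = (\<Sum>j\<le>n. smult (poly ((pderiv ^^ j) D) s) (h j))"
      using h D0 by blast
    have Dj: "\<bar>poly ((pderiv ^^ j) D) s\<bar> \<le> \<eta>" if "j \<le> n" for j
    proof (cases "j = 0")
      case True
      then show ?thesis using D0 S(3) \<eta> by simp
    next
      case False
      then have "j \<in> {1..n}" using that by auto
      then have "\<bar>poly ((pderiv ^^ j) (lagrange_poly (S \<union> N) f)) s - limit_deriv m E f j s\<bar> < \<eta>"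
        using 1 by blast
      then show ?thesis using P(3)[OF \<open>j \<in> {1..n}\<close>] by (simp add: D_def higher_pderiv_diff)
    qed
    have "\<bar>poly ((pderiv ^^ i) D) y\<bar> =
      \<bar>\<Sum>j\<le>n. poly ((pderiv ^^ j) D) s * poly ((pderiv ^^ i) (h j)) y\<bar>"
      by (subst D) (simp add: higher_pderiv_sum higher_pderiv_smult poly_sum)
    also have "\<dots> \<le> (\<Sum>j\<le>n. \<bar>poly ((pderiv ^^ j) D) s\<bar> * \<bar>poly ((pderiv ^^ i) (h j)) y\<bar>)"
      by (rule order.trans[OF sum_abs]) (simp add: abs_mult)
    also have "\<dots> \<le> \<eta> * B"
      unfolding B_def sum_distrib_left using Dj by (intro sum_mono mult_right_mono) auto
    finally show ?case using \<eta>(2) by (simp add: D_def higher_pderiv_diff)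
  qed
qed

section \<open>The sets $S_x$\<close>

lemma infdist_finite_attained:
  fixes A :: "real set"
  assumes "finite A" "A \<noteq> {}"
  obtains w where "w \<in> A" "infdist z A = \<bar>z - w\<bar>"
  using infdist_attains_inf[OF finite_imp_closed[OF assms(1)] assms(2), of z] by (auto simp: dist_real_def)

locale choice_fun =
  fixes m :: nat and E :: "real set" and a :: "real set \<Rightarrow> real"
  assumes m_ge_1: "1 \<le> m" and large: "infinite E \<or> m + 1 \<le> card E"
    and choice: "is_choice_fun E a"
begin

abbreviation Y :: "real \<Rightarrow> nat \<Rightarrow> real set" where "Y x j \<equiv> y_pt a x ` {0..j}"
abbreviation N :: "real \<Rightarrow> nat" where "N \<equiv> stop_index m E a"
abbreviation S :: "real \<Rightarrow> real set" where "S \<equiv> S_set m E a"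
abbreviation s :: "real \<Rightarrow> real" where "s \<equiv> s_pt m E a"

lemma Y_Suc: "Y x (Suc j) = insert (a (Y x j)) (Y x j)"
  by (simp add: atLeast0_atMost_Suc)

lemma stop_index_le: "N x \<le> m - 1"
  unfolding stop_index_def by (rule Least_le) simp

lemma stop_index_cases: "N x = m - 1 \<or> y_pt a x (N x) islimpt E"
  unfolding stop_index_def by (rule LeastI[of _ "m - 1"]) simp

lemma not_islimpt_before_stop:
  assumes "j < N x"
  shows "\<not> y_pt a x j islimpt E"
  using not_less_Least[OF assms[unfolded stop_index_def]] by simp

lemma not_islimpt_Y: "j < N x \<Longrightarrow> z \<in> Y x j \<Longrightarrow> \<not> z islimpt E"
  using not_islimpt_before_stop by auto

text \<open>Before the stopping index \<open>Y x j\<close> has fewer than \<open>m\<close> points,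
  so it is not all of \<open>E\<close>, and it contains no limit point; hence the nearest-point
  clause of \<open>is_choice_fun\<close> applies.\<close>

lemma choice_Y:
  assumes "Y x j \<subseteq> E" "j < N x"
  shows "y_pt a x (Suc j) \<in> E - Y x j"
    and "e \<in> E - Y x j \<Longrightarrow> infdist (y_pt a x (Suc j)) (Y x j) \<le> infdist e (Y x j)"
proof -
  have "Y x j \<noteq> E"
  proof
    assume e: "Y x j = E"
    then have "finite E" by (metis finite_atLeastAtMost finite_imageI)
    moreover have "card (Y x j) \<le> Suc j" using card_image_le[of "{0..j}" "y_pt a x"] by simp
    ultimately show False using e large assms(2) stop_index_le[of x] by simp
  qed
  moreover have "\<forall>z\<in>Y x j. \<not> z islimpt E" using not_islimpt_Y[OF assms(2)] by blast
  moreover have "finite (Y x j)" "Y x j \<noteq> {}" by auto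
  ultimately have "a (Y x j) \<in> E - Y x j \<and>
      (\<forall>y\<in>E - Y x j. infdist (a (Y x j)) (Y x j) \<le> infdist y (Y x j))"
    using choice assms(1) unfolding is_choice_fun_def by meson
  then show "y_pt a x (Suc j) \<in> E - Y x j"
    and "e \<in> E - Y x j \<Longrightarrow> infdist (y_pt a x (Suc j)) (Y x j) \<le> infdist e (Y x j)"
    by auto
qed

lemma Y_subset_card:
  assumes "x \<in> E" "j \<le> N x"
  shows "Y x j \<subseteq> E \<and> card (Y x j) = Suc j"
  using assms(2)
proof (induction j)
  case 0
  then show ?case using assms(1) by simp
next
  case (Suc j)
  then have IH: "Y x j \<subseteq> E" "card (Y x j) = Suc j" by auto
  have "a (Y x j) \<in> E - Y x j" using choice_Y(1)[OF IH(1)] Suc.prems by simp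
  then show ?case unfolding Y_Suc using IH by simp
qed

lemmas Y_subset = Y_subset_card[THEN conjunct1]
lemmas card_Y = Y_subset_card[THEN conjunct2]

text \<open>A point of \<open>E\<close> between the new point and the old point nearest to it would
  be nearer still and would have been chosen. So each \<open>Y x j\<close> is a run of consecutive
  points of \<open>E\<close>.\<close>

lemma Y_interval:
  assumes "x \<in> E" "j \<le> N x" "e \<in> E" "u \<in> Y x j" "v \<in> Y x j" "u \<le> e" "e \<le> v"
  shows "e \<in> Y x j"
  using assms(2-)
proof (induction j arbitrary: u v)
  case 0
  then show ?case by auto
next
  case (Suc j)
  define y where "y = y_pt a x (Suc j)"
  have Ys: "Y x (Suc j) = insert y (Y x j)" by (simp add: y_def Y_Suc)
  have sub: "Y x j \<subseteq> E" using Y_subset assms(1) Suc.prems(1) by simp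
  obtain w where w: "w \<in> Y x j" "infdist y (Y x j) = \<bar>y - w\<bar>"
    using infdist_finite_attained[of "Y x j" y] by auto
  show ?case
  proof (rule ccontr)
    assume e: "e \<notin> Y x (Suc j)"
    then have ne: "e \<noteq> y" "e \<notin> Y x j" using Ys by auto
    then have "\<bar>y - w\<bar> \<le> infdist e (Y x j)"
      using choice_Y(2)[OF sub, of e] Suc.prems(1,2) w(2) by (simp add: y_def)
    also have "\<dots> \<le> \<bar>e - w\<bar>" using infdist_le[OF w(1), of e] by (simp add: dist_real_def)
    finally have yw: "\<bar>y - w\<bar> \<le> \<bar>e - w\<bar>" .
    have IH: "\<not> (u' \<le> e \<and> e \<le> v')" if "u' \<in> Y x j" "v' \<in> Y x j" for u' v'
      using Suc.IH[OF _ Suc.prems(2) that] Suc.prems(1) ne by auto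
    consider "u \<in> Y x j" "v \<in> Y x j" | "u = y" "v \<in> Y x j" | "u \<in> Y x j" "v = y" | "u = y" "v = y"
      using Suc.prems(3,4) unfolding Ys by auto
    then show False
    proof cases
      case 2
      then show ?thesis using IH[OF w(1) 2(2)] Suc.prems(5,6) ne yw by auto
    next
      case 3
      then show ?thesis using IH[OF 3(1) w(1)] Suc.prems(5,6) ne yw by auto
    qed (use IH Suc.prems(5,6) ne in auto)
  qed
qed

section \<open>Structure and monotonicity of \<open>S x\<close>\<close>

lemma S_eq: "S x = Y x (N x)" by (simp add: S_set_def)

lemma s_mem: "s x \<in> S x" by (simp add: S_set_def s_pt_def)

lemma x_mem: "x \<in> S x"
  unfolding S_set_def by (rule image_eqI[of _ _ 0]) auto

lemma finite_S [simp]: "finite (S x)" by (simp add: S_set_def)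

lemma S_subset: "x \<in> E \<Longrightarrow> S x \<subseteq> E" unfolding S_eq by (rule Y_subset) auto

lemma card_S_le: "x \<in> E \<Longrightarrow> card (S x) \<le> m"
  unfolding S_eq using card_Y[of x "N x"] stop_index_le[of x] m_ge_1 by simp

lemma S_interval:
  "x \<in> E \<Longrightarrow> e \<in> E \<Longrightarrow> u \<in> S x \<Longrightarrow> v \<in> S x \<Longrightarrow> u \<le> e \<Longrightarrow> e \<le> v \<Longrightarrow> e \<in> S x"
  unfolding S_eq by (rule Y_interval) auto

lemma islimpt_s: "x \<in> E \<Longrightarrow> card (S x) < m \<Longrightarrow> s x islimpt E"
  unfolding S_eq s_pt_def using card_Y[of x "N x"] stop_index_cases[of x] by auto

text \<open>The construction stops as soon as it meets a limit point.\<close>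

lemma islimpt_in_S: "z \<in> S x \<Longrightarrow> z islimpt E \<Longrightarrow> z = s x"
proof -
  assume "z \<in> S x" "z islimpt E"
  then obtain j where "j \<le> N x" "z = y_pt a x j" "\<not> j < N x"
    unfolding S_eq using not_islimpt_before_stop[of _ x] by fastforce
  then show "z = s x" by (simp add: s_pt_def)
qed

text \<open>Both constructions are compared step by step, each frozen once it stops. A step adds at
  most one point to a run of \<open>E\<close>, so an end that is strictly behind can catch up but
  not overtake. If two ends coincide, one run contains the other: runs of equal size are then equal
  and continue identically, and a run that stopped early at a limit point cannot lie in one that is
  still growing.\<close>

lemma S_mono:
  assumes x: "x \<in> E" "x' \<in> E" "x \<le> x'"
  shows "Min (S x) \<le> Min (S x') \<and> Max (S x) \<le> Max (S x')"
proof -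
  define Z where "Z z j = Y z (min j (N z))" for z j
  have Zfin: "finite (Z z j)" "Z z j \<noteq> {}" for z j by (auto simp: Z_def)
  have mn: "Min (Z z j) \<in> Z z j" "Max (Z z j) \<in> Z z j" "u \<in> Z z j \<Longrightarrow> Min (Z z j) \<le> u"
    "u \<in> Z z j \<Longrightarrow> u \<le> Max (Z z j)" for z j u
    using Zfin by auto
  have ZE: "Z z j \<subseteq> E" if "z \<in> E" for z j
    unfolding Z_def using that by (intro Y_subset) auto
  have Zint: "e \<in> Z z j" if "z \<in> E" "e \<in> E" "u \<in> Z z j" "v \<in> Z z j" "u \<le> e" "e \<le> v" for z e u v j
    using Y_interval[OF that(1) _ that(2), of "min j (N z)" u v] that(3-) by (simp add: Z_def)
  have grow_or_stop: "Z z (Suc j) = (if j < N z then insert (a (Y z j)) (Y z j) else Z z j)" for z j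
  proof (cases "j < N z")
    case True
    then have "min (Suc j) (N z) = Suc j" "min j (N z) = j" by simp_all
    then show ?thesis using True by (simp only: Z_def Y_Suc if_True)
  next
    case False
    then have "min (Suc j) (N z) = min j (N z)" by simp
    then show ?thesis using False by (simp only: Z_def if_False)
  qed
  have grow: "\<exists>q. Z z (Suc j) \<subseteq> insert q (Z z j)" for z j
    unfolding grow_or_stop by (auto simp: Z_def)
  have incr: "Z z j \<subseteq> Z z (Suc j)" for z j
    unfolding Z_def by (intro image_mono) auto
  \<comment> \<open>Otherwise the new run would contain its own minimum and also
    \<open>Min (Z x j)\<close>, two points that the old run lacks.\<close>
  have Min_strict: "Min (Z x j) \<le> Min (Z x' (Suc j))" if "Min (Z x j) < Min (Z x' j)" for j
  proof (rule ccontr)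
    assume n: "\<not> Min (Z x j) \<le> Min (Z x' (Suc j))"
    have "Min (Z x j) \<in> E" using mn(1) ZE[OF x(1)] by blast
    moreover have "Min (Z x' j) \<in> Z x' (Suc j)" using mn(1) incr by blast
    ultimately have "Min (Z x j) \<in> Z x' (Suc j)"
      using Zint[OF x(2) _ mn(1)[of x' "Suc j"], of "Min (Z x j)" "Min (Z x' j)"] n that by linarith
    moreover have "Min (Z x j) \<notin> Z x' j" "Min (Z x' (Suc j)) \<notin> Z x' j"
      using mn(3)[of "Min (Z x j)" x' j] mn(3)[of "Min (Z x' (Suc j))" x' j] n that by auto
    moreover have "Min (Z x' (Suc j)) \<noteq> Min (Z x j)" using n by auto
    ultimately show False using grow[of x' j] mn(1)[of x' "Suc j"] by blast
  qed
  have Max_strict: "Max (Z x (Suc j)) \<le> Max (Z x' j)" if "Max (Z x j) < Max (Z x' j)" for j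
  proof (rule ccontr)
    assume n: "\<not> Max (Z x (Suc j)) \<le> Max (Z x' j)"
    have "Max (Z x' j) \<in> E" using mn(2) ZE[OF x(2)] by blast
    moreover have "Max (Z x j) \<in> Z x (Suc j)" using mn(2) incr by blast
    ultimately have "Max (Z x' j) \<in> Z x (Suc j)"
      using Zint[OF x(1) _ _ mn(2)[of x "Suc j"], of "Max (Z x' j)" "Max (Z x j)"] n that by linarith
    moreover have "Max (Z x' j) \<notin> Z x j" "Max (Z x (Suc j)) \<notin> Z x j"
      using mn(4)[of "Max (Z x' j)" x j] mn(4)[of "Max (Z x (Suc j))" x j] n that by auto
    moreover have "Max (Z x (Suc j)) \<noteq> Max (Z x' j)" using n by auto
    ultimately show False using grow[of x j] mn(2)[of x "Suc j"] by blast
  qed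
  have "Min (Z x j) \<le> Min (Z x' j) \<and> Max (Z x j) \<le> Max (Z x' j)" for j
  proof (induction j)
    case 0
    then show ?case using x(3) by (simp add: Z_def)
  next
    case (Suc j)
    have subset: "Z x j \<subseteq> Z x' j" if "Min (Z x j) = Min (Z x' j)"
    proof
      fix u assume u: "u \<in> Z x j"
      then show "u \<in> Z x' j"
        using Suc that mn(3)[OF u] mn(4)[OF u] mn(1,2)[of x' j] ZE[OF x(1)]
        by (intro Zint[OF x(2), of u "Min (Z x' j)" _ "Max (Z x' j)"]) auto
    qed
    have superset: "Z x' j \<subseteq> Z x j" if "Max (Z x j) = Max (Z x' j)"
    proof
      fix u assume u: "u \<in> Z x' j"
      then show "u \<in> Z x j"
        using Suc that mn(3)[OF u] mn(4)[OF u] mn(1,2)[of x j] ZE[OF x(2)]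
        by (intro Zint[OF x(1), of u "Min (Z x j)" _ "Max (Z x j)"]) auto
    qed
    have Min_anti: "Min (Z z (Suc j)) \<le> Min (Z z j)" and Max_anti: "Max (Z z j) \<le> Max (Z z (Suc j))" for z
      using incr[of z j] Zfin by (auto intro: Min_antimono Max_mono)
    have stopped: "Z z (Suc j) = Z z j \<and> Z z j = Y z (N z)" if "N z \<le> j" for z
      using that by (simp add: Z_def min_def)
    have running: "Z z j = Y z j" if "j < N z" for z
      using that by (simp add: Z_def min_def)
    \<comment> \<open>\<open>N z \<le> j < N z' \<le> m - 1\<close> rules out a stop by size, so
      \<open>z\<close> stopped at a limit point.\<close>
    have lim: "\<exists>u\<in>Z z j. u islimpt E" if "N z \<le> j" "j < N z'" for z z'
      using stopped[OF that(1)] stop_index_cases[of z] that stop_index_le[of z'] by force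
    have nolim: "\<not> u islimpt E" if "j < N z" "u \<in> Z z j" for z u
      using not_islimpt_Y[of j z u] that running by auto
    consider "j < N x" "j < N x'" | "N x \<le> j" "j < N x'" | "j < N x" "N x' \<le> j" | "N x \<le> j" "N x' \<le> j"
      by linarith
    then show ?case
    proof cases
      case 1
      show ?thesis
      proof (cases "Z x j = Z x' j")
        case True
        then have "Z x (Suc j) = Z x' (Suc j)"
          using 1 running by (simp add: grow_or_stop)
        then show ?thesis by simp
      next
        case False
        have "card (Z x j) = card (Z x' j)"
          using 1 running card_Y x by simp
        then have "\<not> Z x j \<subseteq> Z x' j" "\<not> Z x' j \<subseteq> Z x j"
          using False Zfin card_subset_eq by metis+
        then have "Min (Z x j) < Min (Z x' j)" "Max (Z x j) < Max (Z x' j)"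
          using Suc subset superset by (auto simp: less_le)
        then show ?thesis
          using Min_strict[of j] Max_strict[of j] Min_anti[of x] Max_anti[of x'] by linarith
      qed
    next
      case 2
      then have "\<not> Z x j \<subseteq> Z x' j" using lim[of x x'] nolim[of x'] by blast
      then have "Min (Z x j) < Min (Z x' j)" using Suc subset by (auto simp: less_le)
      then show ?thesis
        using Min_strict[of j] Suc stopped[OF 2(1)] Max_anti[of x'] by auto
    next
      case 3
      then have "\<not> Z x' j \<subseteq> Z x j" using lim[of x' x] nolim[of x] by blast
      then have "Max (Z x j) < Max (Z x' j)" using Suc superset by (auto simp: less_le)
      then show ?thesis
        using Max_strict[of j] Suc stopped[OF 3(2)] Min_anti[of x] by auto
    next
      case 4
      then show ?thesis using Suc stopped by simp
    qed
  qed
  from this[of "max (N x) (N x')"] show ?thesis by (simp add: Z_def S_eq)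
qed

text \<open>
  If some step of the construction from \<open>x\<close> jumps further than \<open>D = \<bar>x - x'\<bar>\<close>, then the points
  chosen before the first such jump form a cluster of \<open>E\<close> that contains \<open>x'\<close>. The construction
  from \<open>x'\<close> exhausts the same cluster first, and both constructions agree from then on.
\<close>

lemma gap_le:
  assumes x: "x \<in> E" "x' \<in> E" "S x \<noteq> S x'" and i: "i < N x"
  shows "infdist (y_pt a x (Suc i)) (Y x i) \<le> \<bar>x - x'\<bar>"
proof (rule ccontr)
  define D where "D = \<bar>x - x'\<bar>"
  define far where "far j \<longleftrightarrow> j < N x \<and> D < infdist (y_pt a x (Suc j)) (Y x j)" for j
  assume "\<not> ?thesis"
  then have "far i" using i by (simp add: far_def D_def del: y_pt.simps)
  define j where "j = (LEAST j. far j)"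
  have "far j" unfolding j_def by (rule LeastI[of far, OF \<open>far i\<close>])
  then have j: "j < N x" "D < infdist (y_pt a x (Suc j)) (Y x j)" by (auto simp: far_def)
  have close: "infdist (y_pt a x (Suc t)) (Y x t) \<le> D" if "t < j" for t
  proof -
    have "\<not> far t" using that unfolding j_def by (rule not_less_Least)
    then show ?thesis using that j(1) by (simp add: far_def del: y_pt.simps)
  qed
  define C where "C = Y x j"
  have CE: "C \<subseteq> E" "card C = Suc j" "finite C" using Y_subset card_Y x j(1) by (auto simp: C_def)
  have far_C: "D < infdist e C" if "e \<in> E - C" for e
    using choice_Y(2)[of x j e] that CE(1) j unfolding C_def by linarith
  have jm: "j < m - 1" using j(1) stop_index_le[of x] by simp
  have nostop: "i < N x'" if "i \<le> N x'" "i \<le> j" "Y x' i \<subseteq> C" for i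
  proof -
    have "y_pt a x' i \<in> C" using that(3) by auto
    then have "\<not> y_pt a x' i islimpt E" using not_islimpt_Y j(1) unfolding C_def by blast
    then have "i \<noteq> N x'" using stop_index_cases[of x'] that(2) jm by auto
    then show ?thesis using that(1) by simp
  qed
  have sub: "i \<le> N x' \<and> Y x' i \<subseteq> C" if "i \<le> j" for i
    using that
  proof (induction i)
    case 0
    have "x \<in> C" unfolding C_def by (rule image_eqI[of _ _ 0]) auto
    then have "infdist x' C \<le> D"
      using infdist_le[of x C x'] by (simp add: D_def dist_real_def abs_minus_commute)
    then show ?case using far_C[of x'] x(2) by auto
  next
    case (Suc i)
    then have IH: "i \<le> N x'" "Y x' i \<subseteq> C" by auto
    have iN: "i < N x'" using nostop IH Suc.prems by simp
    have YE: "Y x' i \<subseteq> E" using Y_subset x(2) IH(1) by blast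
    have x'Y: "x' \<in> Y x' i" by (rule image_eqI[of _ _ 0]) auto
    \<comment> \<open>The first point of the construction from \<open>x\<close> that is still
      missing serves: at the start \<open>x\<close> itself, at distance \<open>D\<close> from
      \<open>x'\<close>, and later a point that followed its predecessors with a gap of at most
      \<open>D\<close>.\<close>
    have "\<exists>c \<in> C - Y x' i. infdist c (Y x' i) \<le> D"
    proof (cases "x \<in> Y x' i")
      case False
      have "infdist x (Y x' i) \<le> D"
        using infdist_le[OF x'Y, of x] by (simp add: D_def dist_real_def)
      moreover have "x \<in> C" unfolding C_def by (rule image_eqI[of _ _ 0]) auto
      ultimately show ?thesis using False by blast
    next
      case True
      have "\<not> C \<subseteq> Y x' i"
      proof
        assume "C \<subseteq> Y x' i"
        then have "card C \<le> card (Y x' i)" by (intro card_mono) auto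
        then show False using CE(2) card_Y[OF x(2) IH(1)] Suc.prems by simp
      qed
      then have ex: "\<exists>t. t \<le> j \<and> y_pt a x t \<notin> Y x' i" unfolding C_def by auto
      define t where "t = (LEAST t. t \<le> j \<and> y_pt a x t \<notin> Y x' i)"
      have t: "t \<le> j" "y_pt a x t \<notin> Y x' i" using LeastI_ex[OF ex] unfolding t_def by auto
      then have "t \<noteq> 0" using True by (metis y_pt.simps(1))
      then obtain r where r: "t = Suc r" using not0_implies_Suc by blast
      have "y_pt a x q \<in> Y x' i" if "q \<le> r" for q
        using not_less_Least[of q "\<lambda>t. t \<le> j \<and> y_pt a x t \<notin> Y x' i"] that r t(1)
        unfolding t_def[symmetric] by auto
      then have "Y x r \<subseteq> Y x' i" by auto
      then have "infdist (y_pt a x t) (Y x' i) \<le> infdist (y_pt a x t) (Y x r)"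
        by (intro infdist_mono) auto
      also have "\<dots> \<le> D" using close[of r] t(1) unfolding r by simp
      finally show ?thesis using t unfolding C_def by (intro bexI[of _ "y_pt a x t"]) auto
    qed
    then obtain c where c: "c \<in> C" "c \<notin> Y x' i" "infdist c (Y x' i) \<le> D" by blast
    have "infdist (y_pt a x' (Suc i)) (Y x' i) \<le> D"
      using choice_Y(2)[OF YE iN, of c] c CE(1) by auto
    moreover have "infdist (y_pt a x' (Suc i)) C \<le> infdist (y_pt a x' (Suc i)) (Y x' i)"
      using IH(2) x'Y by (intro infdist_mono) auto
    ultimately have "y_pt a x' (Suc i) \<in> C"
      using far_C[of "y_pt a x' (Suc i)"] choice_Y(1)[OF YE iN] by fastforce
    then show ?case using IH(2) iN unfolding Y_Suc by simp
  qed
  have jN: "j < N x'" using sub[of j] nostop by blast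
  have YC: "Y x' j = C"
    using sub[of j] CE card_Y[OF x(2), of j] by (intro card_subset_eq) auto
  \<comment> \<open>\<open>a\<close> sees only the set chosen so far, so the order in which the
    cluster was collected no longer matters.\<close>
  have Yeq: "Y x i = Y x' i" if "j \<le> i" for i
    using that
  proof (induction i rule: dec_induct)
    case base
    then show ?case using YC by (simp add: C_def)
  next
    case (step i)
    then show ?case by (simp only: Y_Suc)
  qed
  have yeq: "y_pt a x i = y_pt a x' i" if "j < i" for i
    using Yeq[of "i - 1"] that by (cases i) auto
  have "N x \<le> N x'"
    unfolding stop_index_def[of _ _ _ x] using stop_index_cases[of x'] yeq[OF jN] by (intro Least_le) simp
  moreover have "N x' \<le> N x"
    unfolding stop_index_def[of _ _ _ x'] using stop_index_cases[of x] yeq[OF j(1)] by (intro Least_le) simp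
  ultimately have "N x = N x'" by simp
  then have "S x = S x'" unfolding S_eq using Yeq[of "N x"] j(1) by simp
  then show False using x(3) by simp
qed

text \<open>There are at most \<open>m - 1\<close> steps, and by \<open>gap_le\<close> each reaches
  at most \<open>\<bar>x - x'\<bar>\<close> beyond the earlier points.\<close>

lemma S_dist_le:
  assumes x: "x \<in> E" "x' \<in> E" "S x \<noteq> S x'" and "u \<in> S x" "v \<in> S x"
  shows "\<bar>u - v\<bar> \<le> (real m - 1) * \<bar>x - x'\<bar>"
proof -
  define D where "D = \<bar>x - x'\<bar>"
  have "\<bar>u - v\<bar> \<le> real j * D" if "j \<le> N x" "u \<in> Y x j" "v \<in> Y x j" for j u v
    using that
  proof (induction j arbitrary: u v)
    case 0
    then show ?case by simp
  next
    case (Suc j)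
    define y where "y = y_pt a x (Suc j)"
    have Ys: "Y x (Suc j) = insert y (Y x j)" by (simp add: y_def Y_Suc)
    have IH: "\<bar>u' - v'\<bar> \<le> real j * D" if "u' \<in> Y x j" "v' \<in> Y x j" for u' v'
      using Suc.IH that Suc.prems(1) by simp
    obtain w where w: "w \<in> Y x j" "infdist y (Y x j) = \<bar>y - w\<bar>"
      using infdist_finite_attained[of "Y x j" y] by auto
    have "\<bar>y - w\<bar> \<le> D"
      using gap_le[OF x, of j] Suc.prems(1) w(2) by (simp add: y_def D_def del: y_pt.simps)
    then have y: "\<bar>y - u'\<bar> \<le> real (Suc j) * D" if "u' \<in> Y x j" for u'
      using IH[OF w(1) that] by (simp add: algebra_simps)
    have "0 \<le> D" by (simp add: D_def)
    then show ?case
      using Suc.prems(2,3) y[of u] y[of v] IH[of u v] unfolding Ys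
      by (auto simp: abs_minus_commute algebra_simps)
  qed
  from this[of "N x" u v] have "\<bar>u - v\<bar> \<le> real (N x) * D" using assms unfolding S_eq by simp
  also have "\<dots> \<le> (real m - 1) * D"
    using stop_index_le[of x] m_ge_1 by (intro mult_right_mono) (auto simp: D_def)
  finally show ?thesis by (simp add: D_def)
qed

end

section \<open>The sets $H(x)$\<close>

text \<open>Writing the side as a sign lets both orientations be handled through
  \<open>side E z * (e - z)\<close>. Where \<open>E\<close> accumulates from both sides, the right
  one is taken.\<close>

definition side :: "real set \<Rightarrow> real \<Rightarrow> real" where
  "side E z = (if z islimpt E \<inter> {z<..} then 1 else -1)"

lemma side_cases: "side E z = 1 \<or> side E z = -1"
  by (simp add: side_def)

lemma islimpt_side:
  assumes "z islimpt E"
  shows "z islimpt {e\<in>E. 0 < side E z * (e - z)}"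
proof (cases "z islimpt E \<inter> {z<..}")
  case True
  moreover have "{e\<in>E. 0 < side E z * (e - z)} = E \<inter> {z<..}" using True by (auto simp: side_def)
  ultimately show ?thesis by simp
next
  case False
  have "z islimpt E - {z}" using assms islimpt_punctured by blast
  moreover have "E - {z} = E \<inter> {z<..} \<union> E \<inter> {..<z}" by auto
  ultimately have "z islimpt E \<inter> {..<z}" using False islimpt_Un by metis
  moreover have "{e\<in>E. 0 < side E z * (e - z)} = E \<inter> {..<z}" using False by (auto simp: side_def)
  ultimately show ?thesis by simp
qed

text \<open>All \<open>m\<close> distances are fixed at once, so that a single sequence at
  \<open>z\<close> serves every \<open>x\<close> that ends there.\<close>

lemma side_points_exist:
  fixes m :: nat
  assumes "z islimpt E" "0 < \<delta>"
  shows "\<exists>d. strict_mono_on {..<m} d \<and>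
    (\<forall>j<m. 0 < d j \<and> d j < \<delta> \<and> z + side E z * d j \<in> E)"
proof -
  let ?\<sigma> = "side E z"
  obtain T where T: "finite T" "T \<subseteq> {e\<in>E. 0 < ?\<sigma> * (e - z)}" "card T = m" "\<And>u. u \<in> T \<Longrightarrow> \<bar>u - z\<bar> < \<delta>"
    by (rule islimpt_superset_near[OF islimpt_side[OF assms(1)] assms(2), of "{}" m]) auto
  define U where "U = (\<lambda>e. ?\<sigma> * (e - z)) ` T"
  have "card U = m" "finite U"
    unfolding U_def using T(1,3) side_cases[of E z] by (auto simp: card_image inj_on_def)
  then obtain d where d: "strict_mono_on {..<m} d" "d ` {..<m} = U"
    using finite_strict_mono_enumeration[of U] by metis
  have "0 < d j \<and> d j < \<delta> \<and> z + ?\<sigma> * d j \<in> E" if "j < m" for j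
  proof -
    have "d j \<in> U" using that d(2) by blast
    then obtain e where e: "e \<in> T" "d j = ?\<sigma> * (e - z)" unfolding U_def by blast
    moreover have "z + ?\<sigma> * (?\<sigma> * (e - z)) = e" "?\<sigma> * (e - z) \<le> \<bar>e - z\<bar>" using side_cases[of E z] by auto
    ultimately show ?thesis using T(2) T(4)[OF e(1)] by fastforce
  qed
  then show ?thesis using d(1) by blast
qed

context choice_fun
begin

text \<open>A point of \<open>S x\<close> on that side would enclose infinitely many points of
  \<open>E\<close> between itself and \<open>s x\<close>, and the finite run \<open>S x\<close>
  would have to contain them.\<close>

lemma side_S:
  assumes x: "x \<in> E" "card (S x) < m" and u: "u \<in> S x"
  shows "side E (s x) * (u - s x) \<le> 0"
proof (rule ccontr)
  let ?\<sigma> = "side E (s x)"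
  assume n: "\<not> ?thesis"
  then have "0 < \<bar>u - s x\<bar>" by auto
  then have "infinite ({e\<in>E. 0 < ?\<sigma> * (e - s x)} \<inter> ball (s x) \<bar>u - s x\<bar>)"
    using islimpt_side[OF islimpt_s[OF x]] islimpt_eq_infinite_ball by blast
  moreover have "{e\<in>E. 0 < ?\<sigma> * (e - s x)} \<inter> ball (s x) \<bar>u - s x\<bar> \<subseteq> S x"
  proof safe
    fix e assume e: "e \<in> E" "0 < ?\<sigma> * (e - s x)" "e \<in> ball (s x) \<bar>u - s x\<bar>"
    then have "s x \<le> e \<and> e \<le> u \<or> u \<le> e \<and> e \<le> s x"
      using n side_cases[of E "s x"] by (auto simp: dist_real_def)
    then show "e \<in> S x" using S_interval[OF x(1) e(1)] s_mem u by blast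
  qed
  ultimately show False using finite_S finite_subset by blast
qed

lemma whitney_field_approx:
  assumes bd: "divided_diff_bound m f E C \<alpha>" "0 \<le> C" "0 < \<alpha>" and x: "x \<in> E" and \<epsilon>: "0 < \<epsilon>"
  shows "\<forall>\<^sub>F \<delta> in at_right 0. \<forall>K. finite K \<longrightarrow> K \<subseteq> E \<longrightarrow> K \<inter> S x = {} \<longrightarrow> card K = m - card (S x) \<longrightarrow>
    (\<forall>u\<in>K. \<bar>u - s x\<bar> < \<delta>) \<longrightarrow>
    \<bar>poly ((pderiv ^^ i) (whitney_field m E a f x)) y - poly ((pderiv ^^ i) (lagrange_poly (S x \<union> K) f)) y\<bar> < \<epsilon>"
proof (cases "card (S x) = m")
  case True
  then show ?thesis using \<epsilon> by (auto simp: whitney_field_def)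
next
  case False
  then have c: "card (S x) < m" using card_S_le[OF x] by simp
  define n where "n = m - card (S x)"
  have cS: "0 < card (S x)" using s_mem by (auto simp: card_gt_0_iff)
  have n: "card (S x) - 1 + n = m - 1" "card (S x) + n = m" using c cS by (auto simp: n_def)
  have P: "degree (whitney_field m E a f x) \<le> m - 1 \<and>
      (\<forall>y\<in>S x. poly (whitney_field m E a f x) y = f y) \<and>
      (\<forall>j\<in>{1..n}. poly ((pderiv ^^ j) (whitney_field m E a f x)) (s x) = limit_deriv m E f j (s x))"
    using theI'[OF hermite_ex1[OF finite_S s_mem[of x], of n f "\<lambda>j. limit_deriv m E f j (s x)", unfolded n(1)]] False
    by (simp add: whitney_field_def flip: n_def)
  show ?thesis
    unfolding n_def[symmetric]
    by (rule hermite_approx[OF bd islimpt_s[OF x c] finite_S S_subset[OF x] s_mem n(2) \<epsilon>]) (use P in auto)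
qed

end

text \<open>\<open>d\<close> is indexed by limit points, not by elements of \<open>X\<close>, so
  points that share \<open>s x\<close> share their distances. The factor 2 in
  \<open>separated\<close> keeps the \<open>\<delta>\<close>-neighbourhoods of distinct points
  apart.\<close>

locale separated_sets = choice_fun +
  fixes X :: "real set" and \<delta> :: real and d :: "real \<Rightarrow> nat \<Rightarrow> real"
  assumes X: "finite X" "X \<subseteq> E" and \<delta>_pos: "0 < \<delta>"
    and separated: "\<And>x x' u v. x \<in> X \<Longrightarrow> x' \<in> X \<Longrightarrow> u \<in> S x \<Longrightarrow> v \<in> S x' \<Longrightarrow> u \<noteq> v \<Longrightarrow>
      2 * \<delta> \<le> \<bar>u - v\<bar>"
    and d_mono: "\<And>z. z islimpt E \<Longrightarrow> strict_mono_on {..<m} (d z)"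
    and d: "\<And>z j. z islimpt E \<Longrightarrow> j < m \<Longrightarrow> 0 < d z j \<and> d z j < \<delta> \<and> z + side E z * d z j \<in> E"
begin

definition ext :: "real \<Rightarrow> real set" where
  "ext x = (\<lambda>j. s x + side E (s x) * d (s x) j) ` {..<m - card (S x)}"

definition H :: "real \<Rightarrow> real set" where "H x = S x \<union> ext x"

definition V :: "real set" where "V = (\<Union>x\<in>X. H x)"

section \<open>Size, order and diameter of \<open>H x\<close>\<close>

lemma XE: "x \<in> X \<Longrightarrow> x \<in> E" using X by blast

lemma extE:
  assumes "x \<in> X" "w \<in> ext x"
  obtains j where "card (S x) < m" "s x islimpt E" "j < m - card (S x)" "j < m"
    "w = s x + side E (s x) * d (s x) j" "side E (s x) * (w - s x) = d (s x) j"
    "\<bar>w - s x\<bar> = d (s x) j" "0 < d (s x) j" "d (s x) j < \<delta>" "w \<in> E"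
proof -
  obtain j where j: "j < m - card (S x)" "w = s x + side E (s x) * d (s x) j"
    using assms(2) by (auto simp: ext_def)
  then have lim: "card (S x) < m" "s x islimpt E" using islimpt_s[OF XE[OF assms(1)]] by auto
  have dj: "0 < d (s x) j" "d (s x) j < \<delta>" "w \<in> E" using d[OF lim(2), of j] j by auto
  have "side E (s x) * (w - s x) = d (s x) j" "\<bar>w - s x\<bar> = d (s x) j"
    using side_cases[of E "s x"] j(2) dj(1) by auto
  then show thesis using that[of j] j lim dj by auto
qed

lemma finite_H [simp]: "finite (H x)" by (simp add: H_def ext_def)

lemma H_ne: "H x \<noteq> {}" using x_mem by (auto simp: H_def)

lemma ext_near:
  assumes "x \<in> X" "w \<in> ext x"
  shows "card (S x) < m" "0 < side E (s x) * (w - s x)" "\<bar>w - s x\<bar> < \<delta>"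
  using extE[OF assms] by metis+

lemma ext_disjoint: "x \<in> X \<Longrightarrow> ext x \<inter> S x = {}"
  using side_S[OF XE] ext_near(1,2) by (meson disjoint_iff linorder_not_le)

lemma card_ext: "x \<in> X \<Longrightarrow> card (ext x) = m - card (S x)"
proof (cases "card (S x) < m")
  case True
  assume x: "x \<in> X"
  have "inj_on (d (s x)) {..<m}"
    using d_mono[OF islimpt_s[OF XE[OF x] True]] by (rule strict_mono_on_imp_inj_on)
  then have "inj_on (d (s x)) {..<m - card (S x)}" by (rule inj_on_subset) auto
  then have "inj_on (\<lambda>j. s x + side E (s x) * d (s x) j) {..<m - card (S x)}"
    using side_cases[of E "s x"] by (auto simp: inj_on_def)
  then show ?thesis unfolding ext_def by (simp add: card_image)
qed (simp add: ext_def)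

lemma card_H: "x \<in> X \<Longrightarrow> card (H x) = m"
  unfolding H_def using card_ext[of x] ext_disjoint[of x] card_S_le[OF XE, of x]
  by (subst card_Un_disjoint) (auto simp: ext_def)

lemma ext_subset: "x \<in> X \<Longrightarrow> ext x \<subseteq> E"
  by (auto elim: extE)

lemma H_subset: "x \<in> X \<Longrightarrow> H x \<subseteq> E"
  using S_subset[OF XE] ext_subset by (auto simp: H_def)

lemma eq_if_near:
  assumes "x \<in> X" "x' \<in> X" "u \<in> S x" "v \<in> S x'" "\<bar>u - v\<bar> < 2 * \<delta>"
  shows "u = v"
  using separated[OF assms(1-4)] assms(5) by auto

text \<open>Since \<open>S x\<close> is a run of \<open>E\<close>, an intruder \<open>w\<close> can
  only lie between \<open>s x\<close> and an added point, hence within \<open>\<delta>\<close> of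
  \<open>s x\<close>. By separation it belongs to no \<open>S x'\<close>, so it was added for some
  \<open>x'\<close>, and then \<open>s x' = s x\<close>. Both added points come from the same
  sequence, and \<open>w\<close>, being no farther away, lies in the initial segment used for
  \<open>x\<close>.\<close>

lemma H_interval:
  assumes x: "x \<in> X" and w: "w \<in> V" and uv: "u \<in> H x" "v \<in> H x" "u \<le> w" "w \<le> v"
  shows "w \<in> H x"
proof (rule ccontr)
  assume wn: "w \<notin> H x"
  then have wS: "w \<notin> S x" "w \<notin> ext x" by (auto simp: H_def)
  obtain x' where x': "x' \<in> X" "w \<in> H x'" using w by (auto simp: V_def)
  have wE: "w \<in> E" using H_subset x' by blast
  let ?\<sigma> = "side E (s x)"
  have noint: "\<not> (u' \<le> w \<and> w \<le> v')" if "u' \<in> S x" "v' \<in> S x" for u' v'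
    using S_interval[OF XE[OF x] wE that] wS by blast
  then have "u \<in> ext x \<or> v \<in> ext x" using uv by (auto simp: H_def)
  then have lim: "card (S x) < m" "s x islimpt E" using x by (auto elim: extE)
  have \<sigma>: "?\<sigma> * (t - s x) > 0 \<longleftrightarrow> t \<in> ext x" if "t \<in> H x" for t
    using that side_S[OF XE[OF x] lim(1), of t] ext_near(2)[OF x, of t] unfolding H_def by fastforce
  have "\<exists>t\<in>ext x. 0 < ?\<sigma> * (w - s x) \<and> ?\<sigma> * (w - s x) \<le> ?\<sigma> * (t - s x)"
  proof (cases "?\<sigma> = 1")
    case True
    have "s x < w"
    proof (rule ccontr)
      assume "\<not> s x < w"
      then have "u \<notin> ext x" using \<sigma>[OF uv(1)] True uv(3) by auto
      then show False using noint[of u "s x"] uv(1,3) s_mem \<open>\<not> s x < w\<close> by (auto simp: H_def)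
    qed
    then show ?thesis using \<sigma>[OF uv(2)] True uv(4) by (intro bexI[of _ v]) auto
  next
    case False
    then have m1: "?\<sigma> = -1" using side_cases by blast
    have "w < s x"
    proof (rule ccontr)
      assume "\<not> w < s x"
      then have "v \<notin> ext x" using \<sigma>[OF uv(2)] m1 uv(4) by auto
      then show False using noint[of "s x" v] uv(2,4) s_mem \<open>\<not> w < s x\<close> by (auto simp: H_def)
    qed
    then show ?thesis using \<sigma>[OF uv(1)] m1 uv(3) by (intro bexI[of _ u]) auto
  qed
  then obtain t where t: "t \<in> ext x" "0 < ?\<sigma> * (w - s x)" "?\<sigma> * (w - s x) \<le> ?\<sigma> * (t - s x)" by blast
  obtain j where j: "j < m - card (S x)" "j < m" "?\<sigma> * (t - s x) = d (s x) j" "d (s x) j < \<delta>"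
    using extE[OF x t(1)] by metis
  have near: "\<bar>w - s x\<bar> < \<delta>" "w \<noteq> s x" using side_cases[of E "s x"] t(2,3) j by auto
  have "w \<in> ext x'"
  proof (rule ccontr)
    assume "w \<notin> ext x'"
    then have "w \<in> S x'" using x'(2) by (simp add: H_def)
    then show False using eq_if_near[OF x'(1) x, of w "s x"] s_mem near \<delta>_pos by simp
  qed
  then obtain j' where j': "j' < m" "w = s x' + side E (s x') * d (s x') j'"
      "side E (s x') * (w - s x') = d (s x') j'" "\<bar>w - s x'\<bar> < \<delta>"
    using extE[OF x'(1)] by metis
  have s_eq: "s x' = s x"
    using eq_if_near[OF x'(1) x s_mem s_mem] near j'(4) by linarith
  then have "d (s x) j' \<le> d (s x) j" using j'(3) j(3) t(3) by metis
  then have "j' \<le> j"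
    using strict_mono_on_less_eq[OF d_mono[OF lim(2)], of j' j] j j' by simp
  then have "w \<in> ext x" unfolding ext_def using j' j s_eq by (intro image_eqI[of _ _ j']) auto
  then show False using wS by simp
qed

lemma H_subset_V: "x \<in> X \<Longrightarrow> H x \<subseteq> V" by (auto simp: V_def)

lemma mem_HI:
  assumes "x \<in> X" "w \<in> V" "Min (H x) \<le> w" "w \<le> Max (H x)"
  shows "w \<in> H x"
  using H_interval[OF assms(1,2) _ _ assms(3,4)] H_ne by simp

text \<open>Both sets are runs of \<open>V\<close> with \<open>m\<close> points, so nested ends
  force equality.\<close>

lemma H_eqI:
  assumes "x \<in> X" "x' \<in> X" "Min (H x') \<le> Min (H x)" "Max (H x) \<le> Max (H x')"
  shows "H x = H x'"
proof -
  have "H x \<subseteq> H x'"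
  proof
    fix w assume w: "w \<in> H x"
    then have "Min (H x) \<le> w" "w \<le> Max (H x)" by auto
    then have "Min (H x') \<le> w" "w \<le> Max (H x')" using assms(3,4) by linarith+
    then show "w \<in> H x'" using mem_HI[OF assms(2)] w H_subset_V[OF assms(1)] by blast
  qed
  then show ?thesis using card_H[OF assms(1)] card_H[OF assms(2)] card_subset_eq[of "H x'" "H x"] by simp
qed

text \<open>If this fails, both ends are out of order by \<open>H_eqI\<close>. The ends of
  \<open>S x\<close> and \<open>S x'\<close> are in order, so \<open>Min (H x')\<close> was added to
  the left of \<open>s x'\<close> and \<open>Max (H x)\<close> to the right of \<open>s x\<close>.
  Separation makes \<open>s x'\<close> the minimum of \<open>S x\<close>, so the two limit points
  coincide, but a limit point has only one side.\<close>

lemma H_mono: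
  assumes x: "x \<in> X" "x' \<in> X" "x \<le> x'"
  shows "Min (H x) \<le> Min (H x') \<and> Max (H x) \<le> Max (H x')"
proof (rule ccontr)
  assume n: "\<not> ?thesis"
  then have lt: "Min (H x') < Min (H x)" "Max (H x') < Max (H x)"
    using H_eqI[OF x(1,2)] H_eqI[OF x(2,1)] by (metis linorder_le_cases linorder_not_less order_refl)+
  have S: "Min (S x) \<le> Min (S x')" "Max (S x) \<le> Max (S x')" using S_mono XE x by auto
  have Sne: "S z \<noteq> {}" for z using s_mem by auto
  have MinH: "Min (H z) \<le> Min (S z)" and MaxH: "Max (S z) \<le> Max (H z)" for z
    using Sne[of z] by (auto intro!: Min_antimono Max_mono simp: H_def ext_def)
  have "Min (H x') < Min (S x')" using lt(1) MinH[of x] S(1) by linarith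
  moreover have "Min (H x') \<in> H x'" using H_ne by simp
  ultimately have "Min (H x') \<in> ext x'" unfolding H_def by (metis Min_le UnE finite_S linorder_not_less)
  then obtain j where j: "card (S x') < m" "s x' islimpt E"
      "\<bar>Min (H x') - s x'\<bar> = d (s x') j" "0 < d (s x') j" "d (s x') j < \<delta>"
      "side E (s x') * (Min (H x') - s x') = d (s x') j"
    using extE[OF x(2)] by metis
  have "Max (S x) < Max (H x)" using lt(2) MaxH[of x'] S(2) by linarith
  moreover have "Max (H x) \<in> H x" using H_ne by simp
  ultimately have "Max (H x) \<in> ext x" unfolding H_def by (metis Max_ge UnE finite_S linorder_not_less)
  then obtain j' where j': "card (S x) < m" "s x islimpt E" "0 < d (s x) j'"
      "side E (s x) * (Max (H x) - s x) = d (s x) j'"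
    using extE[OF x(1)] by metis
  have "Min (H x') < s x'" using \<open>Min (H x') < Min (S x')\<close> s_mem[of x'] by (meson Min_le finite_S less_le_trans)
  then have m1: "side E (s x') = -1" using side_cases[of E "s x'"] j by auto
  have "s x < Max (H x)" using \<open>Max (S x) < Max (H x)\<close> s_mem[of x] by (meson Max_ge finite_S le_less_trans)
  then have p1: "side E (s x) = 1" using side_cases[of E "s x"] j' by auto
  have "s x' \<le> Min (S x')"
    using side_S[OF XE[OF x(2)] j(1), of "Min (S x')"] Sne m1 by simp
  then have eq: "s x' = Min (S x')" using s_mem[of x'] by (intro antisym) auto
  have "Min (S x) = s x'"
  proof (rule eq_if_near[OF x(1,2)])
    have "s x' - \<delta> < Min (S x)" using j(3,5) lt(1) MinH[of x] by linarith
    then show "\<bar>Min (S x) - s x'\<bar> < 2 * \<delta>" using S(1) eq \<delta>_pos by auto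
  qed (use Sne s_mem in auto)
  then have "s x' = s x" using islimpt_in_S[of "s x'" x] j(2) Sne[of x] by (metis Min_in finite_S)
  then show False using m1 p1 by simp
qed

text \<open>Different \<open>H\<close> require different \<open>S\<close>: the set
  \<open>ext x\<close> depends only on \<open>S x\<close>, because if it is nonempty,
  \<open>s x\<close> is the only limit point in \<open>S x\<close>. All added points lie on one side
  of \<open>s x\<close>, so \<open>\<delta>\<close> is paid only once.\<close>

lemma H_diameter:
  assumes x: "x \<in> X" "x' \<in> X" and ne: "H x \<noteq> H x'"
  shows "diameter (H x) \<le> (real m - 1) * \<bar>x - x'\<bar> + \<delta>"
proof -
  define D where "D = (real m - 1) * \<bar>x - x'\<bar>"
  have D: "0 \<le> D" using m_ge_1 by (simp add: D_def)
  have "S x \<noteq> S x'"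
  proof
    assume eq: "S x = S x'"
    have "ext x = ext x'"
    proof (cases "card (S x) < m")
      case True
      then have "s x = s x'" using islimpt_in_S[of "s x" x'] islimpt_s[OF XE[OF x(1)]] eq s_mem by auto
      then show ?thesis using eq by (simp add: ext_def)
    qed (simp add: eq ext_def)
    then show False using ne eq by (simp add: H_def)
  qed
  then have S: "\<bar>u - v\<bar> \<le> D" if "u \<in> S x" "v \<in> S x" for u v
    unfolding D_def using S_dist_le[OF XE XE] x that by blast
  have "\<bar>u - v\<bar> \<le> D + \<delta>" if "u \<in> H x" "v \<in> H x" for u v
  proof -
    note ext = ext_near(3)[OF x(1)]
    have both: "\<bar>w - w'\<bar> < \<delta>" if w: "w \<in> ext x" "w' \<in> ext x" for w w'
      using ext_near(2)[OF x(1) w(1)] ext_near(2)[OF x(1) w(2)] ext[OF w(1)] ext[OF w(2)]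
        side_cases[of E "s x"] by auto
    show ?thesis
      using that S[of u v] S[of u "s x"] S[of "s x" v] ext[of u] ext[of v] both[of u v] s_mem[of x] D \<delta>_pos
      unfolding H_def by fastforce
  qed
  then show ?thesis using D \<delta>_pos by (intro diameter_le) (auto simp: D_def)
qed

lemma H_diameter_sum:
  assumes x: "x \<in> X" "x' \<in> X" and ne: "H x \<noteq> H x'"
  shows "diameter (H x) + diameter (H x') \<le> 2 * (real m + 1) * \<bar>x - x'\<bar>"
proof -
  define D where "D = \<bar>x - x'\<bar>"
  have "x \<noteq> x'" using ne by blast
  then have \<delta>: "2 * \<delta> \<le> D" "0 \<le> D" using separated[OF x x_mem x_mem] by (simp_all add: D_def)
  have "diameter (H x) \<le> (real m - 1) * D + \<delta>" "diameter (H x') \<le> (real m - 1) * D + \<delta>"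
    using H_diameter[OF x ne] H_diameter[OF x(2,1) ne[symmetric]]
    by (simp_all add: D_def abs_minus_commute)
  \<comment> \<open>The two \<open>\<delta>\<close> cost at most one \<open>D\<close>; relaxing this
    to \<open>4 * D\<close> gives the stated constant.\<close>
  with \<delta> have "diameter (H x) + diameter (H x') \<le> 2 * ((real m - 1) * D) + 4 * D" by linarith
  also have "\<dots> = 2 * (real m + 1) * D" by (simp add: algebra_simps)
  finally show ?thesis by (simp add: D_def)
qed

text \<open>A point of \<open>V\<close> between the two comes from some \<open>H y\<close> with
  \<open>y \<le> x\<close> or \<open>x' \<le> y\<close>. Monotonicity of the ends puts it into the
  span of \<open>H x\<close> or of \<open>H x'\<close>, and each of these has \<open>m - 1\<close>
  points besides \<open>x\<close> or \<open>x'\<close>.\<close>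

lemma card_V_between:
  assumes x: "x \<in> X" "x' \<in> X" "x < x'" and consec: "X \<inter> {x<..<x'} = {}"
  shows "card (V \<inter> {x<..<x'}) \<le> 2 * m - 2"
proof -
  have mem: "z \<in> H z" for z using x_mem by (simp add: H_def)
  have "V \<inter> {x<..<x'} \<subseteq> (H x - {x}) \<union> (H x' - {x'})"
  proof
    fix w assume "w \<in> V \<inter> {x<..<x'}"
    then have w: "w \<in> V" "x < w" "w < x'" by auto
    then obtain y where y: "y \<in> X" "w \<in> H y" by (auto simp: V_def)
    have "y \<notin> {x<..<x'}" using consec y(1) by blast
    then have "y \<le> x \<or> x' \<le> y" by auto
    then show "w \<in> (H x - {x}) \<union> (H x' - {x'})"
    proof
      assume "y \<le> x"
      then have "w \<le> Max (H x)" using H_mono[OF y(1) x(1)] y(2) by (meson Max_ge finite_H order_trans)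
      moreover have "Min (H x) \<le> w" using mem[of x] w(2) by (meson Min_le finite_H less_imp_le order_trans)
      ultimately show ?thesis using mem_HI[OF x(1) w(1)] w by auto
    next
      assume "x' \<le> y"
      then have "Min (H x') \<le> w" using H_mono[OF x(2) y(1)] y(2) by (meson Min_le finite_H order_trans)
      moreover have "w \<le> Max (H x')" using mem[of x'] w(3) by (meson Max_ge finite_H less_imp_le order_trans)
      ultimately show ?thesis using mem_HI[OF x(2) w(1)] w by auto
    qed
  qed
  then have "card (V \<inter> {x<..<x'}) \<le> card ((H x - {x}) \<union> (H x' - {x'}))" by (intro card_mono) auto
  also have "\<dots> \<le> card (H x - {x}) + card (H x' - {x'})" by (rule card_Un_le)
  also have "\<dots> = 2 * m - 2" using card_H x mem by simp
  finally show ?thesis .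
qed

lemma H_consecutive:
  assumes v: "strict_mono_on {1..l} v" "V = v ` {1..l}" and x: "x \<in> X"
  shows "\<exists>i j. 1 \<le> i \<and> i \<le> j \<and> j = i + m - 1 \<and> j \<le> l \<and> H x = v ` {i..j}"
proof -
  have "Min (H x) \<in> V" "Max (H x) \<in> V" using H_ne H_subset_V[OF x] by auto
  then obtain i j where i: "i \<in> {1..l}" "Min (H x) = v i" and j: "j \<in> {1..l}" "Max (H x) = v j"
    using v(2) by blast
  have H: "H x = v ` {i..j}"
  proof (intro equalityI subsetI)
    fix w assume w: "w \<in> H x"
    then obtain q where q: "q \<in> {1..l}" "w = v q" using H_subset_V[OF x] v(2) by blast
    have "v i \<le> v q" "v q \<le> v j" using w i j q by (auto simp flip: i(2) j(2))
    then have "i \<le> q" "q \<le> j" using strict_mono_on_less_eq[OF v(1)] i(1) j(1) q(1) by auto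
    then show "w \<in> v ` {i..j}" using q(2) by auto
  next
    fix w assume "w \<in> v ` {i..j}"
    then obtain q where q: "w = v q" "i \<le> q" "q \<le> j" by auto
    then have ql: "q \<in> {1..l}" using i j by auto
    then have "v i \<le> w" "w \<le> v j" using strict_mono_on_less_eq[OF v(1)] i(1) j(1) q by auto
    then show "w \<in> H x" using mem_HI[OF x, of w] i j ql q v(2) by auto
  qed
  have "inj_on v {i..j}"
    using strict_mono_on_imp_inj_on[OF v(1)] by (rule inj_on_subset) (use i j in auto)
  then have "m = Suc j - i" using card_H[OF x] unfolding H by (simp add: card_image)
  moreover have "1 \<le> i" "j \<le> l" using i j by auto
  ultimately show ?thesis using H m_ge_1 by (intro exI[of _ i] exI[of _ j]) auto
qed

end

section \<open>Choice of \<open>\<delta>\<close> and proof of the five properties\<close>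

theorem lemma4p9:
  fixes m k :: nat and p \<epsilon> :: real and E :: "real set" and f :: "real \<Rightarrow> real"
    and a :: "real set \<Rightarrow> real" and x :: "nat \<Rightarrow> real"
  assumes "m \<ge> 1" and "1 < p"
    and "closed E" and "infinite E \<or> card E \<ge> m + 1"
    and "variational_norm m p f E < \<infinity>"
    and "is_choice_fun E a"
    and "k \<ge> 1" and "\<epsilon> > 0"
    and "strict_mono_on {1..k} x" and "x ` {1..k} \<subseteq> E"
  defines "X \<equiv> x ` {1..k}"
    and "P \<equiv> whitney_field m E a f"
  shows "\<exists>(l::nat) (v :: nat \<Rightarrow> real) (V :: real set) (H :: real \<Rightarrow> real set).
    l \<ge> 1 \<and> l \<ge> m \<and> strict_mono_on {1..l} v \<and> V = v ` {1..l} \<and> V \<subseteq> E \<and>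
    (\<forall>z\<in>X. H z \<subseteq> V) \<and>
    \<comment> \<open>(1)\<close>
    (\<forall>z\<in>X. \<exists>j1 j2. 1 \<le> j1 \<and> j1 \<le> j2 \<and> j2 = j1 + m - 1 \<and> j2 \<le> l \<and> H z = v ` {j1..j2}) \<and>
    \<comment> \<open>(2)\<close>
    (\<forall>z\<in>X. z \<in> H z) \<and> X \<subseteq> V \<and>
    (\<forall>i\<in>{1..k - 1}. \<forall>c\<in>{1..l}. \<forall>c'\<in>{1..l}.
       x i = v c \<and> x (i + 1) = v c' \<longrightarrow> 0 < int c' - int c \<and> int c' - int c \<le> 2 * int m) \<and>
    \<comment> \<open>(3)\<close>
    (\<forall>x'\<in>X. \<forall>x''\<in>X. x' < x'' \<longrightarrow> Min (H x') \<le> Min (H x'') \<and> Max (H x') \<le> Max (H x'')) \<and>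
    \<comment> \<open>(4)\<close>
    (\<forall>x'\<in>X. \<forall>x''\<in>X. H x' \<noteq> H x'' \<longrightarrow>
       diameter (H x') + diameter (H x'') \<le> 2 * (real m + 1) * \<bar>x' - x''\<bar>) \<and>
    \<comment> \<open>(5)\<close>
    (\<forall>z\<in>X. \<forall>y\<in>X. \<forall>i\<in>{0..m - 1}.
       \<bar>poly ((pderiv ^^ i) (P z)) y - poly ((pderiv ^^ i) (lagrange_poly (H z) f)) y\<bar> < \<epsilon>)"
proof -
  interpret choice_fun m E a
    using assms(1,4,6) by unfold_locales
  have finX: "finite X" and XE: "X \<subseteq> E" and Xne: "X \<noteq> {}" using assms(7,10) by (auto simp: X_def)
  obtain C where C: "0 \<le> C" "divided_diff_bound m f E C (1 - 1 / p)"
    using variational_norm_divided_diff_bound[OF assms(5,2)] by blast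
  have \<alpha>: "0 < 1 - 1 / p" using assms(2) by simp
  define F where "F = (\<Union>z\<in>X. S z)"
  have finF: "finite F" using finX by (simp add: F_def)
  have "\<forall>\<^sub>F \<delta> in at_right 0. \<forall>u\<in>F. \<forall>v\<in>F. u \<noteq> v \<longrightarrow> 2 * \<delta> \<le> \<bar>u - v\<bar>"
  proof (intro eventually_ball_finite finF ballI)
    fix u v :: real
    show "\<forall>\<^sub>F \<delta> in at_right 0. u \<noteq> v \<longrightarrow> 2 * \<delta> \<le> \<bar>u - v\<bar>"
    proof (cases "u = v")
      case False
      then show ?thesis
        unfolding eventually_at_right_field by (intro exI[of _ "\<bar>u - v\<bar> / 2"]) auto
    qed simp
  qed
  \<comment> \<open>All admissible \<open>K\<close> are covered, because the added points are chosen
    only after \<open>\<delta>\<close>.\<close>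
  moreover have "\<forall>\<^sub>F \<delta> in at_right 0. \<forall>z\<in>X. \<forall>y\<in>X. \<forall>i\<in>{0..m - 1}.
      \<forall>K. finite K \<longrightarrow> K \<subseteq> E \<longrightarrow> K \<inter> S z = {} \<longrightarrow> card K = m - card (S z) \<longrightarrow>
      (\<forall>u\<in>K. \<bar>u - s z\<bar> < \<delta>) \<longrightarrow>
      \<bar>poly ((pderiv ^^ i) (P z)) y - poly ((pderiv ^^ i) (lagrange_poly (S z \<union> K) f)) y\<bar> < \<epsilon>"
    unfolding P_def using XE
    by (intro eventually_ball_finite finX finite_atLeastAtMost ballI
        whitney_field_approx[OF C(2,1) \<alpha> _ assms(8)]) auto
  ultimately have "\<forall>\<^sub>F \<delta> in at_right 0. 0 < \<delta> \<and> (\<forall>u\<in>F. \<forall>v\<in>F. u \<noteq> v \<longrightarrow> 2 * \<delta> \<le> \<bar>u - v\<bar>) \<and>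
    (\<forall>z\<in>X. \<forall>y\<in>X. \<forall>i\<in>{0..m - 1}.
      \<forall>K. finite K \<longrightarrow> K \<subseteq> E \<longrightarrow> K \<inter> S z = {} \<longrightarrow> card K = m - card (S z) \<longrightarrow>
      (\<forall>u\<in>K. \<bar>u - s z\<bar> < \<delta>) \<longrightarrow>
      \<bar>poly ((pderiv ^^ i) (P z)) y - poly ((pderiv ^^ i) (lagrange_poly (S z \<union> K) f)) y\<bar> < \<epsilon>)"
    using eventually_at_right_less[of "0 :: real"] by eventually_elim blast
  then obtain \<delta> where \<delta>: "0 < \<delta>" "\<And>u v. u \<in> F \<Longrightarrow> v \<in> F \<Longrightarrow> u \<noteq> v \<Longrightarrow> 2 * \<delta> \<le> \<bar>u - v\<bar>"
    and approx: "\<And>z y i K. z \<in> X \<Longrightarrow> y \<in> X \<Longrightarrow> i \<in> {0..m - 1} \<Longrightarrow>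
      finite K \<Longrightarrow> K \<subseteq> E \<Longrightarrow> K \<inter> S z = {} \<Longrightarrow> card K = m - card (S z) \<Longrightarrow>
      (\<forall>u\<in>K. \<bar>u - s z\<bar> < \<delta>) \<Longrightarrow>
      \<bar>poly ((pderiv ^^ i) (P z)) y - poly ((pderiv ^^ i) (lagrange_poly (S z \<union> K) f)) y\<bar> < \<epsilon>"
    using eventually_happens'[OF trivial_limit_at_right_real] by (smt (verit, best))
  have "\<forall>z. \<exists>d. z islimpt E \<longrightarrow> strict_mono_on {..<m} d \<and>
      (\<forall>j<m. 0 < d j \<and> d j < \<delta> \<and> z + side E z * d j \<in> E)"
    using side_points_exist[OF _ \<delta>(1)] by blast
  then obtain d where d: "\<And>z. z islimpt E \<Longrightarrow> strict_mono_on {..<m} (d z) \<and>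
      (\<forall>j<m. 0 < d z j \<and> d z j < \<delta> \<and> z + side E z * d z j \<in> E)" by metis
  interpret separated_sets m E a X \<delta> d
    using finX XE \<delta> d by unfold_locales (auto simp: F_def)
  have finV: "finite V" using finX by (simp add: V_def)
  obtain w where w: "strict_mono_on {..<card V} w" "w ` {..<card V} = V"
    using finite_strict_mono_enumeration[OF finV] by blast
  define v where "v i = w (i - 1)" for i
  have v: "strict_mono_on {1..card V} v"
    unfolding v_def by (intro strict_mono_onI strict_mono_onD[OF w(1)]) auto
  have "(\<lambda>i. i - 1) ` {1..card V} = {..<card V}"
    by (auto simp: image_def intro!: bexI[of _ "Suc _"])
  then have V_eq: "V = v ` {1..card V}"
    unfolding v_def image_image[of w "\<lambda>i. i - 1", symmetric] using w(2) by simp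
  have mem: "z \<in> H z" for z using x_mem by (simp add: H_def)
  have mV: "m \<le> card V"
    using Xne card_H H_subset_V card_mono[OF finV] by (metis ex_in_conv)
  have gap: "0 < int c' - int c \<and> int c' - int c \<le> 2 * int m"
    if i: "i \<in> {1..k - 1}" and c: "c \<in> {1..card V}" "c' \<in> {1..card V}" and eq: "x i = v c" "x (i + 1) = v c'"
    for i c c'
  proof -
    have ik: "i \<in> {1..k}" "i + 1 \<in> {1..k}" using i by auto
    have lt: "x i < x (i + 1)" using assms(9) ik by (simp add: strict_mono_on_def)
    have cc: "c < c'" using lt strict_mono_on_less[OF v c] eq by simp
    have "X \<inter> {x i<..<x (i + 1)} = {}"
    proof -
      have "\<not> (x i < x j \<and> x j < x (i + 1))" if "j \<in> {1..k}" for j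
        using strict_mono_on_less[OF assms(9)] ik that by auto
      then show ?thesis by (auto simp: X_def)
    qed
    then have "card (V \<inter> {x i<..<x (i + 1)}) \<le> 2 * m - 2"
      using ik lt by (intro card_V_between) (auto simp: X_def)
    moreover have "v ` {c<..<c'} \<subseteq> V \<inter> {x i<..<x (i + 1)}"
      using c V_eq strict_mono_on_less[OF v] unfolding eq by auto
    moreover have "inj_on v {c<..<c'}"
      using strict_mono_on_imp_inj_on[OF v] by (rule inj_on_subset) (use c in auto)
    \<comment> \<open>\<open>c' - Suc c\<close> counts the points of \<open>V\<close> strictly
      between, so in fact \<open>c' - c \<le> 2 * m - 1\<close>.\<close>
    ultimately have "c' - Suc c \<le> 2 * m - 2"
      using card_mono[of "V \<inter> {x i<..<x (i + 1)}" "v ` {c<..<c'}"] finV by (simp add: card_image)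
    then show ?thesis using cc m_ge_1 by linarith
  qed
  have H_approx: "\<bar>poly ((pderiv ^^ i) (P z)) y - poly ((pderiv ^^ i) (lagrange_poly (H z) f)) y\<bar> < \<epsilon>"
    if "z \<in> X" "y \<in> X" "i \<in> {0..m - 1}" for z y i
  proof -
    show ?thesis
      unfolding H_def using that ext_subset ext_disjoint card_ext ext_near(3)
      by (intro approx) (auto simp: ext_def)
  qed
  show ?thesis
  proof (rule exI[of _ "card V"], rule exI[of _ v], rule exI[of _ V], rule exI[of _ H], intro conjI)
    show "1 \<le> card V" using mV m_ge_1 by simp
    show "V \<subseteq> E" using H_subset by (auto simp: V_def)
    show "X \<subseteq> V" using mem by (auto simp: V_def)
    show "\<forall>z\<in>X. H z \<subseteq> V" using H_subset_V by blast
    show "\<forall>z\<in>X. \<exists>j1 j2. 1 \<le> j1 \<and> j1 \<le> j2 \<and> j2 = j1 + m - 1 \<and> j2 \<le> card V \<and> H z = v ` {j1..j2}"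
      using H_consecutive[OF v V_eq] by blast
    show "\<forall>z\<in>X. z \<in> H z" using mem by blast
    show "\<forall>i\<in>{1..k - 1}. \<forall>c\<in>{1..card V}. \<forall>c'\<in>{1..card V}.
       x i = v c \<and> x (i + 1) = v c' \<longrightarrow> 0 < int c' - int c \<and> int c' - int c \<le> 2 * int m"
      using gap by blast
    show "\<forall>x'\<in>X. \<forall>x''\<in>X. x' < x'' \<longrightarrow> Min (H x') \<le> Min (H x'') \<and> Max (H x') \<le> Max (H x'')"
      using H_mono less_imp_le by blast
    show "\<forall>x'\<in>X. \<forall>x''\<in>X. H x' \<noteq> H x'' \<longrightarrow>
       diameter (H x') + diameter (H x'') \<le> 2 * (real m + 1) * \<bar>x' - x''\<bar>"
      using H_diameter_sum by blast
    show "\<forall>z\<in>X. \<forall>y\<in>X. \<forall>i\<in>{0..m - 1}.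
       \<bar>poly ((pderiv ^^ i) (P z)) y - poly ((pderiv ^^ i) (lagrange_poly (H z) f)) y\<bar> < \<epsilon>"
      using H_approx by blast
  qed (fact mV v V_eq)+
qed

end
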